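(* Let $L=(L,\{l_k\}_{k\ge1},\{l'_k\}_{k\ge1})$ be a compatible $L_\infty$-algebra over a field of characteristic $0$, let $N\ge1$, and let $(D,D')_t=\sum_{i=0}^Nt^i(D_i,D'_i)$ be an order $N$ deformation of $L$. Then $(D,D')_t$ is extensible if and only if its obstruction class, i.e. the class in $H^3_c(L,L)$ of the $3$-cocycle $$-\frac12\sum_{i+j=N+1;\ i,j\ge1}\llbracket(D_i,D'_i),(D_j,D'_j)\rrbracket\in C^3_c(L,L),$$ is trivial.
   Context: Signs and shuffles: for $\sigma\in S_n$ and homogeneous elements $x_1,\dots,x_n$, $\epsilon(\sigma)$ is the Koszul sign, defined by $x_{\sigma(1)}\odot\cdots\odot x_{\sigma(n)}=\epsilon(\sigma)\,x_1\odot\cdots\odot x_n$ in the graded symmetric algebra, and $\chi(\sigma)=(-1)^\sigma\epsilon(\sigma)$. $Sh(i,n-i)$ is the set of $\sigma\in S_n$ with $\sigma(1)<\cdots<\sigma(i)$ and $\sigma(i+1)<\cdots<\sigma(n)$. $L_\infty$-algebra: a graded vector space $L$ with skew-symmetric multilinear maps $l_k:L^{\otimes k}\to L$ of degree $2-k$, $k\ge1$, such that for all $n\ge1$, $\sum_{i+j=n+1}\sum_{\sigma\in Sh(i,n-i)}\chi(\sigma)(-1)^{i(j-1)}\,l_j(l_i(x_{\sigma(1)},\dots,x_{\sigma(i)}),x_{\sigma(i+1)},\dots,x_{\sigma(n)})=0$. A compatible $L_\infty$-algebra is a triple $(L,\{l_k\}_{k\ge1},\{l'_k\}_{k\ge1})$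 such that $(L,\{l_k\})$, $(L,\{l'_k\})$ and (equivalently to the compatibility condition) $(L,\{l_k+l'_k\})$ are $L_\infty$-algebras. Coderivations: $V=s^{-1}L$, $V_i=L_{i+1}$, $s:V\to L$ of degree $1$. $SV=\oplus_{n\ge1}S^nV$ is the (reduced) symmetric coalgebra; $\mathrm{Coder}^n(SV)$ is the space of its degree $n$ coderivations, with graded commutator bracket $[D,E]_C=D\circ E-(-1)^{|D||E|}E\circ D$. Put $\rho_k=(-1)^{k(k-1)/2}s^{-1}\circ l_k\circ s^{\otimes k}$, let $\widetilde{\rho_k}$ be its unique lift to a coderivation of $SV$, namely $\widetilde{\rho_k}(v_1\odot\cdots\odot v_n)=\sum_{\sigma\in Sh(k,n-k)}\epsilon(\sigma)\rho_k(v_{\sigma(1)}\odot\cdots\odot v_{\sigma(k)})\odot v_{\sigma(k+1)}\odot\cdots\odot v_{\sigma(n)}$ (zero for $n<k$), and $D=\sum_{k\ge1}\widetilde{\rho_k}$; define $D'$ similarly from $\{l'_k\}$. $\mathrm{Coder}^\bullet_c(SV)=\oplus_{n\ge0}\mathrm{Coder}^n_c(SV)$, where $\mathrm{Coder}^n_c(SV)$ is the direct sum of $n+1$ copies of $\mathrm{Coder}^n(SV)$, is a graded Lie algebra: the $i$-th component of $\llbracket(D_1,\dots,D_{m+1}),(E_1,\dots,E_{n+1})\rrbracket$ is $\sum_{p+q=i+1}[D_p,E_q]_C$ ($1\le p\le m+1$, $1\le q\le n+1$, $1\le i\le m+n+1$). The pair $(D,D')\in\mathrm{Coder}^1_c(SV)$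 satisfies $\llbracket(D,D'),(D,D')\rrbracket=0$. Cohomology: $C^n_c(L,L)=\mathrm{Coder}^{n-1}_c(SV)$ for $n\ge1$, with differential $\delta_c=\llbracket(D,D'),-\rrbracket:C^n_c(L,L)\to C^{n+1}_c(L,L)$; $H^\bullet_c(L,L)$ is the cohomology of this complex. Order $N$ deformation of $L$: a polynomial $(D,D')_t=\sum_{i=0}^Nt^i(D_i,D'_i)$ in $\mathrm{Coder}^1_c(SV)[[t]]/(t^{N+1})$ with $(D_0,D'_0)=(D,D')$ and $\llbracket(D,D')_t,(D,D')_t\rrbracket=0$ modulo $t^{N+1}$. It is extensible if there exists $(D_{N+1},D'_{N+1})\in\mathrm{Coder}^1_c(SV)$ such that $(D,D')_t+t^{N+1}(D_{N+1},D'_{N+1})$ is an order $N+1$ deformation. The displayed element in the claim is a $3$-cocycle in $\{C^\bullet_c(L,L),\delta_c\}$. *)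

theory Defs
  imports
    Complex_Main
    "HOL-Library.Function_Algebras"
    "HOL-Combinatorics.Combinatorics"
begin

section \<open>Graded vector spaces, Koszul signs and shuffles\<close>

text \<open>A graded vector space is a vector space on a type together with an internal direct sum
  decomposition into subspaces \<open>G i\<close>, \<open>i\<close> an integer.\<close>

definition graded_vector_space ::
  "('k::field \<Rightarrow> 'a::ab_group_add \<Rightarrow> 'a) \<Rightarrow> (int \<Rightarrow> 'a set) \<Rightarrow> bool" where
  "graded_vector_space sc G \<longleftrightarrow>
     vector_space sc \<and>
     (\<forall>i. module.subspace sc (G i)) \<and>
     (\<forall>x. \<exists>!c :: int \<Rightarrow> 'a.
        finite {i. c i \<noteq> 0} \<and> (\<forall>i. c i \<in> G i) \<and> x = (\<Sum>i | c i \<noteq> 0. c i))"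

definition linear_on ::
  "'u::ab_group_add set \<Rightarrow> ('k \<Rightarrow> 'u \<Rightarrow> 'u) \<Rightarrow> ('k \<Rightarrow> 'v::ab_group_add \<Rightarrow> 'v) \<Rightarrow> ('u \<Rightarrow> 'v) \<Rightarrow> bool" where
  "linear_on U s t f \<longleftrightarrow>
     (\<forall>x\<in>U. \<forall>y\<in>U. f (x + y) = f x + f y) \<and> (\<forall>c. \<forall>x\<in>U. f (s c x) = t c (f x))"

text \<open>\<open>homogeneous G ds xs\<close>: the entries of \<open>xs\<close> are homogeneous, of the degrees listed in \<open>ds\<close>.
  Signs are computed from \<open>ds\<close>, so that no degree has to be chosen for the zero vector.\<close>

definition homogeneous :: "(int \<Rightarrow> 'a set) \<Rightarrow> int list \<Rightarrow> 'a list \<Rightarrow> bool" where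
  "homogeneous G ds xs \<longleftrightarrow> list_all2 (\<lambda>d x. x \<in> G d) ds xs"

text \<open>Permutations act on the positions \<open>0, \<dots>, n - 1\<close>, and \<open>permute_list \<sigma> xs\<close> is the list
  of the \<open>xs ! \<sigma> i\<close>. The Koszul sign collects a factor for each pair of entries whose order is
  reversed; the lemma \<open>smon_permute\<close> below is its defining property.\<close>

definition koszul :: "(nat \<Rightarrow> nat) \<Rightarrow> int list \<Rightarrow> 'k::field" where
  "koszul \<sigma> ds =
     (\<Prod>(i, j) \<in> {(i, j). i < j \<and> j < length ds \<and> \<sigma> j < \<sigma> i}. (-1) powi (ds ! \<sigma> i * ds ! \<sigma> j))"

definition chi :: "(nat \<Rightarrow> nat) \<Rightarrow> int list \<Rightarrow> 'k::field" where
  "chi \<sigma> ds = of_int (sign \<sigma>) * koszul \<sigma> ds"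

text \<open>\<open>Sh i n\<close> is the set of \<open>(i, n - i)\<close>-shuffles; it is only used for \<open>i \<le> n\<close>.\<close>

definition Sh :: "nat \<Rightarrow> nat \<Rightarrow> (nat \<Rightarrow> nat) set" where
  "Sh i n = {\<sigma>. \<sigma> permutes {..<n} \<and> strict_mono_on {..<i} \<sigma> \<and> strict_mono_on {i..<n} \<sigma>}"


section \<open>Compatible L-infinity algebras\<close>

text \<open>The structure map \<open>l k\<close> is only considered on lists of length \<open>k \<ge> 1\<close>.\<close>

definition L_infinity_algebra ::
  "('k::field_char_0 \<Rightarrow> 'a::ab_group_add \<Rightarrow> 'a) \<Rightarrow> (int \<Rightarrow> 'a set) \<Rightarrow> (nat \<Rightarrow> 'a list \<Rightarrow> 'a) \<Rightarrow> bool" where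
  "L_infinity_algebra sc L l \<longleftrightarrow>
     graded_vector_space sc L \<and>
     (\<forall>k\<ge>1. \<forall>xs. length xs = k \<longrightarrow>
        (\<forall>i<k. linear_on UNIV sc sc (\<lambda>x. l k (xs[i := x])))) \<and>
     (\<forall>k\<ge>1. \<forall>ds xs. length xs = k \<longrightarrow> homogeneous L ds xs \<longrightarrow>
        l k xs \<in> L (sum_list ds + 2 - int k)) \<and>
     (\<forall>k\<ge>1. \<forall>ds xs. length xs = k \<longrightarrow> homogeneous L ds xs \<longrightarrow>
        (\<forall>\<sigma>. \<sigma> permutes {..<k} \<longrightarrow> l k (permute_list \<sigma> xs) = sc (chi \<sigma> ds) (l k xs))) \<and>
     (\<forall>n\<ge>1. \<forall>ds xs. length xs = n \<longrightarrow> homogeneous L ds xs \<longrightarrow>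
        (\<Sum>(i, j) \<in> {(i, j). i + j = n + 1 \<and> 1 \<le> i \<and> 1 \<le> j}. \<Sum>\<sigma>\<in>Sh i n.
           sc (chi \<sigma> ds * (-1) ^ (i * (j - 1)))
              (l j (l i (take i (permute_list \<sigma> xs)) # drop i (permute_list \<sigma> xs)))) = 0)"

definition compatible_L_infinity_algebra ::
  "('k::field_char_0 \<Rightarrow> 'a::ab_group_add \<Rightarrow> 'a) \<Rightarrow> (int \<Rightarrow> 'a set)
     \<Rightarrow> (nat \<Rightarrow> 'a list \<Rightarrow> 'a) \<Rightarrow> (nat \<Rightarrow> 'a list \<Rightarrow> 'a) \<Rightarrow> bool" where
  "compatible_L_infinity_algebra sc L l l' \<longleftrightarrow>
     L_infinity_algebra sc L l \<and>
     L_infinity_algebra sc L l' \<and>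
     L_infinity_algebra sc L (\<lambda>k xs. l k xs + l' k xs)"


section \<open>The reduced symmetric coalgebra\<close>

text \<open>The scalar multiplication of the spaces of scalar-valued functions used below.\<close>

definition fscale :: "'k::field \<Rightarrow> ('x \<Rightarrow> 'k) \<Rightarrow> 'x \<Rightarrow> 'k" where
  "fscale c f = (\<lambda>x. c * f x)"

lemma vector_space_fscale: "vector_space (fscale :: 'k::field \<Rightarrow> ('x \<Rightarrow> 'k) \<Rightarrow> 'x \<Rightarrow> 'k)"
  by unfold_locales (auto simp: fscale_def fun_eq_iff algebra_simps)

text \<open>A graded symmetric multilinear form in any positive number of variables: since
  \<open>V\<^sup>\<otimes>\<^sup>n\<close> is the direct sum of the \<open>V d\<^sub>1 \<otimes> \<dots> \<otimes> V d\<^sub>n\<close>, it is given by its values on homogeneous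
  arguments, and its values on other lists are irrelevant. One \<open>\<phi>\<close> packages one (independent)
  form for each number of variables.\<close>

definition sym_form ::
  "('k::field \<Rightarrow> 'a::ab_group_add \<Rightarrow> 'a) \<Rightarrow> (int \<Rightarrow> 'a set) \<Rightarrow> ('a list \<Rightarrow> 'k) \<Rightarrow> bool" where
  "sym_form sc V \<phi> \<longleftrightarrow>
     (\<forall>ds xs i. homogeneous V ds xs \<longrightarrow> i < length xs \<longrightarrow>
        linear_on (V (ds ! i)) sc (*) (\<lambda>x. \<phi> (xs[i := x]))) \<and>
     (\<forall>ds xs \<sigma>. homogeneous V ds xs \<longrightarrow> \<sigma> permutes {..<length xs} \<longrightarrow>
        \<phi> (permute_list \<sigma> xs) = koszul \<sigma> ds * \<phi> xs)"

text \<open>The quotient \<open>S\<^sup>nV\<close> of \<open>V\<^sup>\<otimes>\<^sup>n\<close> is realised without cosets: over a field it embeds into the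
  dual of the space of its linear forms, that is, of the graded symmetric multilinear forms on
  \<open>V\<close>, and \<open>x\<^sub>1 \<odot> \<dots> \<odot> x\<^sub>n\<close> becomes the evaluation functional \<open>smon sc V [x\<^sub>1, \<dots>, x\<^sub>n]\<close>.
  The universal property of this model is the lemma \<open>lin_ext_ex1\<close> below.\<close>

type_synonym ('a, 'k) sym = "('a list \<Rightarrow> 'k) \<Rightarrow> 'k"

definition smon ::
  "('k::field \<Rightarrow> 'a::ab_group_add \<Rightarrow> 'a) \<Rightarrow> (int \<Rightarrow> 'a set) \<Rightarrow> 'a list \<Rightarrow> ('a, 'k) sym" where
  "smon sc V xs = (\<lambda>\<phi>. if sym_form sc V \<phi> then \<phi> xs else 0)"

lemma smon_permute:
  assumes "homogeneous V ds xs" and "\<sigma> permutes {..<length xs}"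
  shows "smon sc V (permute_list \<sigma> xs) = fscale (koszul \<sigma> ds) (smon sc V xs)"
  using assms by (auto simp: smon_def fscale_def sym_form_def fun_eq_iff)

lemma smon_linear:
  assumes "homogeneous V ds xs" and "i < length xs"
  shows "linear_on (V (ds ! i)) sc fscale (\<lambda>x. smon sc V (xs[i := x]))"
proof -
  have "linear_on (V (ds ! i)) sc (*) (\<lambda>x. \<phi> (xs[i := x]))" if "sym_form sc V \<phi>" for \<phi>
    using that assms unfolding sym_form_def by blast
  then show ?thesis
    by (auto simp: linear_on_def smon_def fscale_def fun_eq_iff)
qed

definition SV ::
  "('k::field \<Rightarrow> 'a::ab_group_add \<Rightarrow> 'a) \<Rightarrow> (int \<Rightarrow> 'a set) \<Rightarrow> ('a, 'k) sym set" where
  "SV sc V = module.span fscale {smon sc V xs |ds xs. homogeneous V ds xs \<and> xs \<noteq> []}"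

definition SV_deg ::
  "('k::field \<Rightarrow> 'a::ab_group_add \<Rightarrow> 'a) \<Rightarrow> (int \<Rightarrow> 'a set) \<Rightarrow> int \<Rightarrow> ('a, 'k) sym set" where
  "SV_deg sc V d =
     module.span fscale {smon sc V xs |ds xs. homogeneous V ds xs \<and> xs \<noteq> [] \<and> sum_list ds = d}"

text \<open>\<open>lin_ext sc V g\<close> is the linear map on \<open>SV\<close> that sends \<open>x\<^sub>1 \<odot> \<dots> \<odot> x\<^sub>n\<close>, with homogeneous
  factors of degrees \<open>ds\<close>, to \<open>g ds [x\<^sub>1, \<dots>, x\<^sub>n]\<close>. Linear maps on \<open>SV\<close> are extended by \<open>0\<close> to
  the whole type, so that equality of functions is equality of maps on \<open>SV\<close>.\<close>

definition is_lin_ext ::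
  "('k::field \<Rightarrow> 'a::ab_group_add \<Rightarrow> 'a) \<Rightarrow> (int \<Rightarrow> 'a set)
     \<Rightarrow> (int list \<Rightarrow> 'a list \<Rightarrow> 'x \<Rightarrow> 'k) \<Rightarrow> (('a, 'k) sym \<Rightarrow> 'x \<Rightarrow> 'k) \<Rightarrow> bool" where
  "is_lin_ext sc V g f \<longleftrightarrow>
     linear_on (SV sc V) fscale fscale f \<and>
     (\<forall>ds xs. homogeneous V ds xs \<longrightarrow> xs \<noteq> [] \<longrightarrow> f (smon sc V xs) = g ds xs) \<and>
     (\<forall>x. x \<notin> SV sc V \<longrightarrow> f x = 0)"

lemma lin_ext_ex1:
  fixes sc :: "'k::field \<Rightarrow> 'a::ab_group_add \<Rightarrow> 'a"
    and g :: "int list \<Rightarrow> 'a list \<Rightarrow> 'x \<Rightarrow> 'k"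
  assumes "\<And>y. \<exists>\<phi>. sym_form sc V \<phi> \<and>
             (\<forall>ds xs. homogeneous V ds xs \<longrightarrow> xs \<noteq> [] \<longrightarrow> \<phi> xs = g ds xs y)"
  shows "\<exists>!f. is_lin_ext sc V g f"
proof -
  interpret S: vector_space "fscale :: 'k \<Rightarrow> ('a, 'k) sym \<Rightarrow> ('a, 'k) sym"
    by (rule vector_space_fscale)
  obtain \<phi> where \<phi>: "\<And>y. sym_form sc V (\<phi> y)"
    and eq: "\<And>y ds xs. homogeneous V ds xs \<Longrightarrow> xs \<noteq> [] \<Longrightarrow> \<phi> y xs = g ds xs y"
    using assms by metis
  have base: "smon sc V xs \<in> SV sc V" if "homogeneous V ds xs" "xs \<noteq> []" for ds xs
    unfolding SV_def by (rule S.span_base) (use that in blast)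
  have sub: "S.subspace (SV sc V)"
    unfolding SV_def by (rule S.subspace_span)
  define f where "f x = (if x \<in> SV sc V then (\<lambda>y. x (\<phi> y)) else 0)" for x :: "('a, 'k) sym"
  have "linear_on (SV sc V) fscale fscale f"
    using S.subspace_add[OF sub] S.subspace_scale[OF sub]
    by (auto simp: linear_on_def f_def fun_eq_iff) (simp_all add: fscale_def)
  moreover have "f (smon sc V xs) = g ds xs" if "homogeneous V ds xs" "xs \<noteq> []" for ds xs
    using that base[OF that] \<phi> eq[OF that] by (simp add: f_def smon_def)
  ultimately have f: "is_lin_ext sc V g f"
    by (auto simp: is_lin_ext_def f_def)
  have "f' = f" if f': "is_lin_ext sc V g f'" for f'
  proof
    fix x
    have lin: "linear_on (SV sc V) fscale fscale f" "linear_on (SV sc V) fscale fscale f'"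
      using f f' by (auto simp: is_lin_ext_def)
    have "x \<in> SV sc V \<and> f' x = f x"
      if "x \<in> S.span {smon sc V xs |ds xs. homogeneous V ds xs \<and> xs \<noteq> []}"
      using that
    proof (induction rule: S.span_induct_alt)
      case base
      have "f'' 0 = 0" if "linear_on (SV sc V) fscale fscale f''"
        for f'' :: "('a, 'k) sym \<Rightarrow> 'x \<Rightarrow> 'k"
        using that S.subspace_0[OF sub] unfolding linear_on_def by (metis add_0 add_cancel_right_left)
      then show ?case using lin S.subspace_0[OF sub] by metis
    next
      case (step c m y)
      then obtain ds xs where m: "m = smon sc V xs" "homogeneous V ds xs" "xs \<noteq> []" by blast
      have "f m = g ds xs" "f' m = g ds xs" using f f' m by (auto simp: is_lin_ext_def)
      moreover have "m \<in> SV sc V" using base m by blast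
      moreover have "fscale c m \<in> SV sc V" by (rule S.subspace_scale[OF sub]) fact
      ultimately show ?case
        using step lin S.subspace_add[OF sub] unfolding linear_on_def by metis
    qed
    then show "f' x = f x"
      using f f' unfolding is_lin_ext_def SV_def[symmetric] by metis
  qed
  with f show ?thesis by blast
qed

definition lin_ext ::
  "('k::field \<Rightarrow> 'a::ab_group_add \<Rightarrow> 'a) \<Rightarrow> (int \<Rightarrow> 'a set)
     \<Rightarrow> (int list \<Rightarrow> 'a list \<Rightarrow> 'x \<Rightarrow> 'k) \<Rightarrow> ('a, 'k) sym \<Rightarrow> 'x \<Rightarrow> 'k" where
  "lin_ext sc V g = (THE f. is_lin_ext sc V g f)"

text \<open>The tensor product \<open>SV \<otimes> SV\<close>, modelled in the same way by functionals on bilinear forms.\<close>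

type_synonym ('a, 'k) sym2 = "(('a, 'k) sym \<Rightarrow> ('a, 'k) sym \<Rightarrow> 'k) \<Rightarrow> 'k"

definition bilinear_form ::
  "('k::field \<Rightarrow> 'a::ab_group_add \<Rightarrow> 'a) \<Rightarrow> (int \<Rightarrow> 'a set)
     \<Rightarrow> (('a, 'k) sym \<Rightarrow> ('a, 'k) sym \<Rightarrow> 'k) \<Rightarrow> bool" where
  "bilinear_form sc V \<beta> \<longleftrightarrow>
     (\<forall>y\<in>SV sc V. linear_on (SV sc V) fscale (*) (\<lambda>x. \<beta> x y)) \<and>
     (\<forall>x\<in>SV sc V. linear_on (SV sc V) fscale (*) (\<lambda>y. \<beta> x y))"

definition tens ::
  "('k::field \<Rightarrow> 'a::ab_group_add \<Rightarrow> 'a) \<Rightarrow> (int \<Rightarrow> 'a set)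
     \<Rightarrow> ('a, 'k) sym \<Rightarrow> ('a, 'k) sym \<Rightarrow> ('a, 'k) sym2" where
  "tens sc V x y = (\<lambda>\<beta>. if bilinear_form sc V \<beta> then \<beta> x y else 0)"

definition SV2 ::
  "('k::field \<Rightarrow> 'a::ab_group_add \<Rightarrow> 'a) \<Rightarrow> (int \<Rightarrow> 'a set) \<Rightarrow> ('a, 'k) sym2 set" where
  "SV2 sc V = module.span fscale {tens sc V x y |x y. x \<in> SV sc V \<and> y \<in> SV sc V}"

text \<open>The coproduct
  \<open>\<Delta>(x\<^sub>1 \<odot> \<dots> \<odot> x\<^sub>n) = \<Sum>\<^sub>i \<Sum>\<^sub>\<sigma> \<epsilon>(\<sigma>) (x\<^bsub>\<sigma> 1\<^esub> \<odot> \<dots> \<odot> x\<^bsub>\<sigma> i\<^esub>) \<otimes> (x\<^bsub>\<sigma> (i + 1)\<^esub> \<odot> \<dots> \<odot> x\<^bsub>\<sigma> n\<^esub>)\<close>,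
  where \<open>i = 1, \<dots>, n - 1\<close> and \<open>\<sigma>\<close> ranges over the \<open>(i, n - i)\<close>-shuffles.\<close>

definition coproduct ::
  "('k::field \<Rightarrow> 'a::ab_group_add \<Rightarrow> 'a) \<Rightarrow> (int \<Rightarrow> 'a set) \<Rightarrow> ('a, 'k) sym \<Rightarrow> ('a, 'k) sym2" where
  "coproduct sc V = lin_ext sc V (\<lambda>ds xs.
     \<Sum>i\<in>{1..<length xs}. \<Sum>\<sigma>\<in>Sh i (length xs).
       fscale (koszul \<sigma> ds)
         (tens sc V (smon sc V (take i (permute_list \<sigma> xs))) (smon sc V (drop i (permute_list \<sigma> xs)))))"

text \<open>The map \<open>f \<otimes> g\<close> on \<open>SV \<otimes> SV\<close> for \<open>g\<close> of degree \<open>q\<close>: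
  \<open>(f \<otimes> g) (x \<otimes> y) = (- 1)\<^bsup>q \<bar>x\<bar>\<^esup> f x \<otimes> g y\<close>.\<close>

definition tens_map ::
  "('k::field \<Rightarrow> 'a::ab_group_add \<Rightarrow> 'a) \<Rightarrow> (int \<Rightarrow> 'a set)
     \<Rightarrow> int \<Rightarrow> (('a, 'k) sym \<Rightarrow> ('a, 'k) sym) \<Rightarrow> (('a, 'k) sym \<Rightarrow> ('a, 'k) sym)
     \<Rightarrow> ('a, 'k) sym2 \<Rightarrow> ('a, 'k) sym2" where
  "tens_map sc V q f g = (THE F.
     linear_on (SV2 sc V) fscale fscale F \<and>
     (\<forall>a. \<forall>x\<in>SV_deg sc V a. \<forall>y\<in>SV sc V.
        F (tens sc V x y) = fscale ((-1) powi (q * a)) (tens sc V (f x) (g y))) \<and>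
     (\<forall>z. z \<notin> SV2 sc V \<longrightarrow> F z = 0))"


section \<open>Coderivations\<close>

type_synonym ('a, 'k) sym_map = "('a, 'k) sym \<Rightarrow> ('a, 'k) sym"

definition Coder ::
  "('k::field \<Rightarrow> 'a::ab_group_add \<Rightarrow> 'a) \<Rightarrow> (int \<Rightarrow> 'a set) \<Rightarrow> int \<Rightarrow> ('a, 'k) sym_map set" where
  "Coder sc V n = {D.
     linear_on (SV sc V) fscale fscale D \<and>
     (\<forall>x. x \<notin> SV sc V \<longrightarrow> D x = 0) \<and>
     (\<forall>d. \<forall>x\<in>SV_deg sc V d. D x \<in> SV_deg sc V (d + n)) \<and>
     (\<forall>x\<in>SV sc V. coproduct sc V (D x) =
        tens_map sc V 0 D id (coproduct sc V x) + tens_map sc V n id D (coproduct sc V x))}"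

text \<open>The degrees \<open>m\<close> and \<open>n\<close> of \<open>D\<close> and \<open>E\<close> are explicit arguments of the brackets.\<close>

definition commutator ::
  "int \<Rightarrow> int \<Rightarrow> ('a, 'k::field) sym_map \<Rightarrow> ('a, 'k) sym_map \<Rightarrow> ('a, 'k) sym_map" where
  "commutator m n D E = (\<lambda>x. D (E x) - fscale ((-1) powi (m * n)) (E (D x)))"

text \<open>An \<open>(n + 1)\<close>-tuple is a function on indices that vanishes outside \<open>1, \<dots>, n + 1\<close>.\<close>

type_synonym ('a, 'k) sym_maps = "nat \<Rightarrow> ('a, 'k) sym_map"

definition Coder_c ::
  "('k::field \<Rightarrow> 'a::ab_group_add \<Rightarrow> 'a) \<Rightarrow> (int \<Rightarrow> 'a set) \<Rightarrow> nat \<Rightarrow> ('a, 'k) sym_maps set" where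
  "Coder_c sc V n =
     {E. (\<forall>i\<in>{1..n+1}. E i \<in> Coder sc V (int n)) \<and> (\<forall>i. i \<notin> {1..n+1} \<longrightarrow> E i = 0)}"

definition bracket_c ::
  "nat \<Rightarrow> nat \<Rightarrow> ('a, 'k::field) sym_maps \<Rightarrow> ('a, 'k) sym_maps \<Rightarrow> ('a, 'k) sym_maps" where
  "bracket_c m n D E = (\<lambda>i.
     if i \<in> {1..m+n+1} then
       (\<Sum>(p, q) \<in> {(p, q). p + q = i + 1 \<and> p \<in> {1..m+1} \<and> q \<in> {1..n+1}}.
          commutator (int m) (int n) (D p) (E q))
     else 0)"

definition scale_c :: "'k::field \<Rightarrow> ('a, 'k) sym_maps \<Rightarrow> ('a, 'k) sym_maps" where
  "scale_c c E = (\<lambda>i x. fscale c (E i x))"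

definition pair_c :: "('a, 'k::field) sym_map \<Rightarrow> ('a, 'k) sym_map \<Rightarrow> ('a, 'k) sym_maps" where
  "pair_c D D' = (\<lambda>i. if i = 1 then D else if i = 2 then D' else 0)"


section \<open>The coderivations of a compatible L-infinity algebra\<close>

text \<open>The desuspension \<open>V = s\<^sup>-\<^sup>1 L\<close> has the underlying vector space of \<open>L\<close>, regraded, and \<open>s\<close> is the
  identity of this space.\<close>

definition desuspension :: "(int \<Rightarrow> 'a set) \<Rightarrow> int \<Rightarrow> 'a set" where
  "desuspension L = (\<lambda>i. L (i + 1))"

text \<open>\<open>\<rho>\<^sub>k = (- 1)\<^bsup>k (k - 1) / 2\<^esup> s\<^sup>-\<^sup>1 \<circ> l\<^sub>k \<circ> s\<^sup>\<otimes>\<^sup>k\<close> at elements of degrees \<open>ds\<close> in \<open>V\<close>. The power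
  of \<open>s\<close> contributes \<open>s\<^sup>\<otimes>\<^sup>k (v\<^sub>1 \<otimes> \<dots> \<otimes> v\<^sub>k) = (- 1)\<^bsup>\<Sum>\<^sub>i (k - i) \<bar>v\<^sub>i\<bar>\<^esup> s v\<^sub>1 \<otimes> \<dots> \<otimes> s v\<^sub>k\<close>, since
  \<open>k - i\<close> copies of \<open>s\<close> pass \<open>v\<^sub>i\<close>; indices start at \<open>0\<close> below.\<close>

definition rho ::
  "('k::field \<Rightarrow> 'a::ab_group_add \<Rightarrow> 'a) \<Rightarrow> (nat \<Rightarrow> 'a list \<Rightarrow> 'a) \<Rightarrow> nat \<Rightarrow> int list \<Rightarrow> 'a list \<Rightarrow> 'a" where
  "rho sc l k ds vs =
     sc ((-1) ^ (k * (k - 1) div 2) * (-1) powi (\<Sum>i<k. (int k - 1 - int i) * ds ! i)) (l k vs)"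

definition rho_lift ::
  "('k::field \<Rightarrow> 'a::ab_group_add \<Rightarrow> 'a) \<Rightarrow> (int \<Rightarrow> 'a set) \<Rightarrow> (nat \<Rightarrow> 'a list \<Rightarrow> 'a)
     \<Rightarrow> nat \<Rightarrow> ('a, 'k) sym_map" where
  "rho_lift sc L l k = lin_ext sc (desuspension L) (\<lambda>ds vs.
     if length vs < k then 0
     else \<Sum>\<sigma>\<in>Sh k (length vs).
       fscale (koszul \<sigma> ds)
         (smon sc (desuspension L)
           (rho sc l k (take k (permute_list \<sigma> ds)) (take k (permute_list \<sigma> vs))
              # drop k (permute_list \<sigma> vs))))"

text \<open>The infinite sum \<open>D = \<Sum>\<^sub>k \<rho>\<^sub>k\<close> of the lifts is locally finite: a given element of \<open>SV\<close> is
  annihilated by almost all summands.\<close>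

definition L_coder ::
  "('k::field \<Rightarrow> 'a::ab_group_add \<Rightarrow> 'a) \<Rightarrow> (int \<Rightarrow> 'a set) \<Rightarrow> (nat \<Rightarrow> 'a list \<Rightarrow> 'a)
     \<Rightarrow> ('a, 'k) sym_map" where
  "L_coder sc L l = (\<lambda>x. \<Sum>k | 1 \<le> k \<and> rho_lift sc L l k x \<noteq> 0. rho_lift sc L l k x)"

definition L_coder_c ::
  "('k::field \<Rightarrow> 'a::ab_group_add \<Rightarrow> 'a) \<Rightarrow> (int \<Rightarrow> 'a set)
     \<Rightarrow> (nat \<Rightarrow> 'a list \<Rightarrow> 'a) \<Rightarrow> (nat \<Rightarrow> 'a list \<Rightarrow> 'a) \<Rightarrow> ('a, 'k) sym_maps" where
  "L_coder_c sc L l l' = pair_c (L_coder sc L l) (L_coder sc L l')"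


section \<open>Cohomology\<close>

text \<open>In the following definitions \<open>n \<ge> 1\<close>.\<close>

definition cochains ::
  "('k::field \<Rightarrow> 'a::ab_group_add \<Rightarrow> 'a) \<Rightarrow> (int \<Rightarrow> 'a set) \<Rightarrow> nat \<Rightarrow> ('a, 'k) sym_maps set" where
  "cochains sc L n = Coder_c sc (desuspension L) (n - 1)"

definition delta_c ::
  "('k::field \<Rightarrow> 'a::ab_group_add \<Rightarrow> 'a) \<Rightarrow> (int \<Rightarrow> 'a set)
     \<Rightarrow> (nat \<Rightarrow> 'a list \<Rightarrow> 'a) \<Rightarrow> (nat \<Rightarrow> 'a list \<Rightarrow> 'a)
     \<Rightarrow> nat \<Rightarrow> ('a, 'k) sym_maps \<Rightarrow> ('a, 'k) sym_maps" where
  "delta_c sc L l l' n = bracket_c 1 (n - 1) (L_coder_c sc L l l')"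

definition cocycles ::
  "('k::field \<Rightarrow> 'a::ab_group_add \<Rightarrow> 'a) \<Rightarrow> (int \<Rightarrow> 'a set)
     \<Rightarrow> (nat \<Rightarrow> 'a list \<Rightarrow> 'a) \<Rightarrow> (nat \<Rightarrow> 'a list \<Rightarrow> 'a) \<Rightarrow> nat \<Rightarrow> ('a, 'k) sym_maps set" where
  "cocycles sc L l l' n = {z \<in> cochains sc L n. delta_c sc L l l' n z = 0}"

definition coboundaries ::
  "('k::field \<Rightarrow> 'a::ab_group_add \<Rightarrow> 'a) \<Rightarrow> (int \<Rightarrow> 'a set)
     \<Rightarrow> (nat \<Rightarrow> 'a list \<Rightarrow> 'a) \<Rightarrow> (nat \<Rightarrow> 'a list \<Rightarrow> 'a) \<Rightarrow> nat \<Rightarrow> ('a, 'k) sym_maps set" where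
  "coboundaries sc L l l' n =
     (if n \<le> 1 then {0} else delta_c sc L l l' (n - 1) ` cochains sc L (n - 1))"

text \<open>\<open>H\<^sup>n\<close> is the quotient \<open>cocycles n // cohomologous n\<close>, with zero element
  \<open>cohomology_class n 0\<close>.\<close>

definition cohomologous ::
  "('k::field \<Rightarrow> 'a::ab_group_add \<Rightarrow> 'a) \<Rightarrow> (int \<Rightarrow> 'a set)
     \<Rightarrow> (nat \<Rightarrow> 'a list \<Rightarrow> 'a) \<Rightarrow> (nat \<Rightarrow> 'a list \<Rightarrow> 'a) \<Rightarrow> nat
     \<Rightarrow> (('a, 'k) sym_maps \<times> ('a, 'k) sym_maps) set" where
  "cohomologous sc L l l' n =
     {(y, z). y \<in> cocycles sc L l l' n \<and> z \<in> cocycles sc L l l' n \<and> y - z \<in> coboundaries sc L l l' n}"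

definition cohomology_class ::
  "('k::field \<Rightarrow> 'a::ab_group_add \<Rightarrow> 'a) \<Rightarrow> (int \<Rightarrow> 'a set)
     \<Rightarrow> (nat \<Rightarrow> 'a list \<Rightarrow> 'a) \<Rightarrow> (nat \<Rightarrow> 'a list \<Rightarrow> 'a) \<Rightarrow> nat
     \<Rightarrow> ('a, 'k) sym_maps \<Rightarrow> ('a, 'k) sym_maps set" where
  "cohomology_class sc L l l' n z = cohomologous sc L l l' n `` {z}"


section \<open>Deformations\<close>

text \<open>A polynomial \<open>\<Sum>\<^sub>i t\<^sup>i (D\<^sub>i, D'\<^sub>i)\<close> modulo \<open>t\<^bsup>N + 1\<^esup>\<close> is its sequence \<open>DD\<close> of coefficients, which
  vanishes above \<open>N\<close>; the bracket is extended bilinearly over the powers of \<open>t\<close>.\<close>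

definition order_deformation ::
  "('k::field \<Rightarrow> 'a::ab_group_add \<Rightarrow> 'a) \<Rightarrow> (int \<Rightarrow> 'a set)
     \<Rightarrow> (nat \<Rightarrow> 'a list \<Rightarrow> 'a) \<Rightarrow> (nat \<Rightarrow> 'a list \<Rightarrow> 'a) \<Rightarrow> nat
     \<Rightarrow> (nat \<Rightarrow> ('a, 'k) sym_maps) \<Rightarrow> bool" where
  "order_deformation sc L l l' N DD \<longleftrightarrow>
     (\<forall>i\<le>N. DD i \<in> Coder_c sc (desuspension L) 1) \<and>
     (\<forall>i>N. DD i = 0) \<and>
     DD 0 = L_coder_c sc L l l' \<and>
     (\<forall>n\<le>N. (\<Sum>(i, j) \<in> {(i, j). i + j = n}. bracket_c 1 1 (DD i) (DD j)) = 0)"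

definition extensible ::
  "('k::field \<Rightarrow> 'a::ab_group_add \<Rightarrow> 'a) \<Rightarrow> (int \<Rightarrow> 'a set)
     \<Rightarrow> (nat \<Rightarrow> 'a list \<Rightarrow> 'a) \<Rightarrow> (nat \<Rightarrow> 'a list \<Rightarrow> 'a) \<Rightarrow> nat
     \<Rightarrow> (nat \<Rightarrow> ('a, 'k) sym_maps) \<Rightarrow> bool" where
  "extensible sc L l l' N DD \<longleftrightarrow>
     (\<exists>X\<in>Coder_c sc (desuspension L) 1. order_deformation sc L l l' (N + 1) (DD(N + 1 := X)))"

definition obstruction :: "nat \<Rightarrow> (nat \<Rightarrow> ('a, 'k::field) sym_maps) \<Rightarrow> ('a, 'k) sym_maps" where
  "obstruction N DD = scale_c (- (1 / 2))
     (\<Sum>(i, j) \<in> {(i, j). i + j = N + 1 \<and> 1 \<le> i \<and> 1 \<le> j}. bracket_c 1 1 (DD i) (DD j))"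

end

theory Submission
  imports Defs
begin

text \<open>All elements involved have degree \<open>1\<close>, so with \<open>A\<^sub>n = \<Sum>\<^bsub>i+j=n\<^esub> D\<^sub>i \<circ> D\<^sub>j\<close> (and \<open>D\<^sub>i\<close> denoting the
  pair \<open>(D\<^sub>i, D'\<^sub>i)\<close>) the deformation equations say \<open>A\<^sub>n = 0\<close> for \<open>n \<le> N\<close>, and the obstruction is
  \<open>- A\<^bsub>N+1\<^esub>\<close>. Associativity gives \<open>\<Sum>\<^bsub>i+j=N+1\<^esub> D\<^sub>i \<circ> A\<^sub>j = \<Sum>\<^bsub>i+j=N+1\<^esub> A\<^sub>i \<circ> D\<^sub>j\<close>, where only the terms
  \<open>D\<^sub>0 \<circ> A\<^bsub>N+1\<^esub>\<close> and \<open>A\<^bsub>N+1\<^esub> \<circ> D\<^sub>0\<close> survive: the obstruction is a cocycle. The coefficient of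
  \<open>t\<^bsup>N+1\<^esup>\<close> in the equation for an extension by \<open>X\<close> is \<open>2 (\<lbrakk>D\<^sub>0, X\<rbrakk> - obstruction)\<close>.

  The remaining work is to show that coderivations are closed under linear combinations and graded
  commutators. This rests on the coproduct being a well-defined linear map into \<open>SV \<otimes> SV\<close>: the
  shuffle formula must be graded symmetric. A permutation acts on \<open>Sh i n\<close>, seen as the set of cosets
  of \<open>S\<^sub>i \<times> S\<^bsub>n-i\<^esub>\<close> in \<open>S\<^sub>n\<close>, that is, of \<open>i\<close>-element subsets, and the summands only depend on
  the coset.\<close>

section \<open>Koszul signs and shuffles\<close>

text \<open>Giving the pairs that stay in order the factor 1 makes the index set independent of
  \<open>\<sigma>\<close>, so the signs of different permutations can be reindexed and multiplied
  factor by factor.\<close>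

lemma koszul_prod_pairs:
  "(koszul \<sigma> ds :: 'k::field) =
     (\<Prod>(i, j)\<in>{(i, j). i < j \<and> j < length ds}.
        if \<sigma> j < \<sigma> i then (-1) powi (ds ! \<sigma> i * ds ! \<sigma> j) else 1)"
proof -
  have "finite {(i, j). i < j \<and> j < length ds}"
    by (rule finite_subset[of _ "{..<length ds} \<times> {..<length ds}"]) auto
  then show ?thesis
    unfolding koszul_def
    by (intro prod.mono_neutral_cong_left) (auto split: if_splits)
qed

lemma minus_one_powi_square: "(-1 :: 'k::field) powi m * (-1) powi m = 1"
  by (cases "even m") auto

text \<open>A pair of positions is inverted by \<open>\<pi> \<circ> \<gamma>\<close> iff either
  \<open>\<gamma>\<close> inverts it or \<open>\<pi>\<close> inverts its image under
  \<open>\<gamma>\<close>, but not both. In the case of both, the factor occurs twice on the right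
  and squares to 1.\<close>

lemma koszul_compose:
  assumes \<pi>: "\<pi> permutes {..<length ds}" and \<gamma>: "\<gamma> permutes {..<length ds}"
  shows "(koszul (\<pi> \<circ> \<gamma>) ds :: 'k::field) = koszul \<pi> ds * koszul \<gamma> (permute_list \<pi> ds)"
proof -
  define n where "n = length ds"
  define P where "P = {(i, j). i < j \<and> j < n}"
  define v :: "nat \<Rightarrow> nat \<Rightarrow> 'k" where "v a b = (-1) powi (ds ! \<pi> a * ds ! \<pi> b)" for a b
  have v_sym: "v a b = v b a" for a b
    by (simp add: v_def mult.commute)
  have lt: "\<gamma> i < n" "inv \<gamma> i < n" if "i < n" for i
    using that permutes_in_image[OF \<gamma>] permutes_in_image[OF permutes_inv[OF \<gamma>]]
    by (auto simp: n_def)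
  have inv: "\<gamma> (inv \<gamma> i) = i" "inv \<gamma> (\<gamma> i) = i" for i
    using permutes_inverses[OF \<gamma>] by auto
  have inj: "\<gamma> i = \<gamma> j \<longleftrightarrow> i = j" "inv \<gamma> i = inv \<gamma> j \<longleftrightarrow> i = j" "\<pi> i = \<pi> j \<longleftrightarrow> i = j" for i j
    using inv permutes_inj[OF \<pi>] by (metis, metis, auto dest: injD)
  have less_iff: "\<gamma> i \<le> \<gamma> j \<longleftrightarrow> \<gamma> i < \<gamma> j" "inv \<gamma> i \<le> inv \<gamma> j \<longleftrightarrow> inv \<gamma> i < inv \<gamma> j"
    "\<not> \<gamma> i < \<gamma> j \<longleftrightarrow> \<gamma> j < \<gamma> i" "\<not> inv \<gamma> i < inv \<gamma> j \<longleftrightarrow> inv \<gamma> j < inv \<gamma> i"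
    if "i < j \<or> j < i" for i j
    using that inj(1,2)[of i j] by (auto simp: order_le_less)
  have nth: "permute_list \<pi> ds ! \<gamma> i = ds ! \<pi> (\<gamma> i)" if "i < n" for i
    using lt[OF that] \<pi> by (simp add: permute_list_nth n_def)
  have "(koszul \<pi> ds :: 'k) = (\<Prod>(a, b)\<in>P. if \<pi> b < \<pi> a then v a b else 1)"
    unfolding koszul_prod_pairs P_def v_def n_def using \<pi> by (intro prod.cong) auto
  \<comment> \<open>Reindexing by \<open>\<gamma>\<close> acts on unordered pairs;
    \<open>min\<close> and \<open>max\<close> restore the order, and \<open>v\<close> may ignore it
    by \<open>v_sym\<close>.\<close>
  also have "\<dots> = (\<Prod>(i, j)\<in>P. if \<pi> (max (\<gamma> i) (\<gamma> j)) < \<pi> (min (\<gamma> i) (\<gamma> j))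
                             then v (\<gamma> i) (\<gamma> j) else 1)"
    by (rule prod.reindex_bij_witness
          [where j = "\<lambda>(a, b). (min (inv \<gamma> a) (inv \<gamma> b), max (inv \<gamma> a) (inv \<gamma> b))"
             and i = "\<lambda>(i, j). (min (\<gamma> i) (\<gamma> j), max (\<gamma> i) (\<gamma> j))"])
       (auto simp: P_def inv lt less_iff min_def max_def v_sym not_le)
  finally have \<pi>_eq: "(koszul \<pi> ds :: 'k) = \<dots>" .
  have \<gamma>_eq: "(koszul \<gamma> (permute_list \<pi> ds) :: 'k) =
      (\<Prod>(i, j)\<in>P. if \<gamma> j < \<gamma> i then v (\<gamma> i) (\<gamma> j) else 1)"
    by (auto simp: koszul_prod_pairs P_def v_def nth n_def[symmetric] intro!: prod.cong)
  have "(koszul (\<pi> \<circ> \<gamma>) ds :: 'k) =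
      (\<Prod>(i, j)\<in>P. if \<pi> (\<gamma> j) < \<pi> (\<gamma> i) then v (\<gamma> i) (\<gamma> j) else 1)"
    unfolding koszul_prod_pairs P_def v_def n_def by (intro prod.cong) auto
  also have "\<dots> = (\<Prod>(i, j)\<in>P.
      (if \<pi> (max (\<gamma> i) (\<gamma> j)) < \<pi> (min (\<gamma> i) (\<gamma> j)) then v (\<gamma> i) (\<gamma> j) else 1) *
      (if \<gamma> j < \<gamma> i then v (\<gamma> i) (\<gamma> j) else 1))"
  proof (rule prod.cong[OF refl], clarsimp, goal_cases)
    case (1 i j)
    then have "\<gamma> i \<noteq> \<gamma> j" "\<pi> (\<gamma> i) \<noteq> \<pi> (\<gamma> j)"
      by (auto simp: P_def inj)
    moreover have "v (\<gamma> i) (\<gamma> j) * v (\<gamma> i) (\<gamma> j) = 1"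
      by (simp add: v_def minus_one_powi_square)
    ultimately show ?case
      by (auto simp: min_def max_def)
  qed
  also have "\<dots> = koszul \<pi> ds * koszul \<gamma> (permute_list \<pi> ds)"
    unfolding \<pi>_eq \<gamma>_eq prod.distrib[symmetric] by (simp add: case_prod_beta)
  finally show ?thesis .
qed

lemma koszul_square: "(koszul \<sigma> ds :: 'k::field) * koszul \<sigma> ds = 1"
  by (simp add: koszul_def prod.distrib[symmetric] case_prod_beta minus_one_powi_square)

text \<open>A permutation that preserves the first block also preserves its complement, hence lies
  in the Young subgroup \<open>S_i \<times> S_(n-i)\<close>. The second component is shifted down by
  \<open>i\<close>.\<close>

lemma permutes_blocks:
  fixes \<gamma> :: "nat \<Rightarrow> nat"
  assumes \<gamma>: "\<gamma> permutes {..<n}" and "i \<le> n" and im: "\<gamma> ` {..<i} = {..<i}"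
  obtains \<alpha> \<beta> where
    "\<alpha> permutes {..<i}" "\<beta> permutes {..<n - i}"
    "\<And>k. k < i \<Longrightarrow> \<gamma> k = \<alpha> k" "\<And>k. k < n - i \<Longrightarrow> \<gamma> (i + k) = i + \<beta> k"
proof -
  have inj: "inj \<gamma>" using \<gamma> by (rule permutes_inj)
  have ge: "i \<le> \<gamma> k \<and> \<gamma> k < n" if "i \<le> k" "k < n" for k
  proof -
    have "\<gamma> k \<notin> \<gamma> ` {..<i}" using that inj by (auto simp: inj_image_mem_iff)
    then have "\<gamma> k \<notin> {..<i}" unfolding im .
    then show ?thesis using that permutes_in_image[OF \<gamma>, of k] by simp
  qed
  define \<alpha> where "\<alpha> k = (if k < i then \<gamma> k else k)" for k
  define \<beta> where "\<beta> k = (if k < n - i then \<gamma> (i + k) - i else k)" for k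
  have "bij_betw \<alpha> {..<i} {..<i}"
    using im inj_on_subset[OF inj] bij_betw_cong[of "{..<i}" \<alpha> \<gamma> "{..<i}"]
    by (simp add: bij_betw_imageI \<alpha>_def)
  then have \<alpha>: "\<alpha> permutes {..<i}"
    by (rule bij_imp_permutes) (simp add: \<alpha>_def)
  have \<beta>_eq: "\<gamma> (i + k) = i + \<beta> k" if "k < n - i" for k
    using that ge[of "i + k"] by (simp add: \<beta>_def)
  have "inj_on \<beta> {..<n - i}"
  proof (rule inj_onI)
    fix x y assume "x \<in> {..<n - i}" "y \<in> {..<n - i}" "\<beta> x = \<beta> y"
    then have "\<gamma> (i + x) = \<gamma> (i + y)" by (simp add: \<beta>_eq)
    then show "x = y" using injD[OF inj] by fastforce
  qed
  moreover have "\<beta> ` {..<n - i} \<subseteq> {..<n - i}"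
  proof
    fix y assume "y \<in> \<beta> ` {..<n - i}"
    then obtain k where k: "k < n - i" "y = \<beta> k" by auto
    have "\<gamma> (i + k) < n" using ge[of "i + k"] k(1) by simp
    then have "\<beta> k < n - i" using \<beta>_eq[OF k(1)] by simp
    then show "y \<in> {..<n - i}" by (simp add: k(2))
  qed
  ultimately have "bij_betw \<beta> {..<n - i} {..<n - i}"
    by (simp add: bij_betw_def endo_inj_surj)
  then have "\<beta> permutes {..<n - i}"
    by (rule bij_imp_permutes) (simp add: \<beta>_def)
  then show thesis
    using \<alpha> \<beta>_eq that[of \<alpha> \<beta>] by (simp add: \<alpha>_def)
qed

lemma
  assumes "i \<le> length xs"
    and \<alpha>: "\<alpha> permutes {..<i}" and \<beta>: "\<beta> permutes {..<length xs - i}"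
    and "\<And>k. k < i \<Longrightarrow> \<gamma> k = \<alpha> k" and "\<And>k. k < length xs - i \<Longrightarrow> \<gamma> (i + k) = i + \<beta> k"
  shows take_permute_list_blocks: "take i (permute_list \<gamma> xs) = permute_list \<alpha> (take i xs)"
    and drop_permute_list_blocks: "drop i (permute_list \<gamma> xs) = permute_list \<beta> (drop i xs)"
proof -
  have lt: "\<alpha> k < i \<longleftrightarrow> k < i" "\<beta> k < length xs - i \<longleftrightarrow> k < length xs - i" for k
    using permutes_in_image[OF \<alpha>, of k] permutes_in_image[OF \<beta>, of k] by simp_all
  show "take i (permute_list \<gamma> xs) = permute_list \<alpha> (take i xs)"
    by (rule nth_equalityI) (use assms(1,4) lt in \<open>simp_all add: permute_list_def\<close>)
  show "drop i (permute_list \<gamma> xs) = permute_list \<beta> (drop i xs)"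
    by (rule nth_equalityI)
      (use assms(1,5) lt in \<open>simp_all add: permute_list_def less_diff_conv add.commute[of _ i]\<close>)
qed

text \<open>No pair with one position in each block is inverted, so the inversions of
  \<open>\<gamma>\<close> are those of \<open>\<alpha>\<close> together with the shifted ones of
  \<open>\<beta>\<close>.\<close>

lemma koszul_blocks:
  assumes "i \<le> length ds"
    and \<alpha>: "\<alpha> permutes {..<i}" and \<beta>: "\<beta> permutes {..<length ds - i}"
    and \<gamma>\<alpha>: "\<And>k. k < i \<Longrightarrow> \<gamma> k = \<alpha> k"
    and \<gamma>\<beta>: "\<And>k. k < length ds - i \<Longrightarrow> \<gamma> (i + k) = i + \<beta> k"
  shows "(koszul \<gamma> ds :: 'k::field) = koszul \<alpha> (take i ds) * koszul \<beta> (drop i ds)"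
proof -
  define n where "n = length ds"
  define w :: "nat \<times> nat \<Rightarrow> 'k" where "w = (\<lambda>(a, b). (-1) powi (ds ! \<gamma> a * ds ! \<gamma> b))"
  define A where "A = {(a, b). a < b \<and> b < i \<and> \<alpha> b < \<alpha> a}"
  define B where "B = {(a, b). a < b \<and> b < n - i \<and> \<beta> b < \<beta> a}"
  let ?sh = "\<lambda>(a, b). (i + a, i + b)"
  have \<alpha>_lt: "\<alpha> k < i" if "k < i" for k
    using that permutes_in_image[OF \<alpha>] by auto
  have \<gamma>_sub: "\<gamma> k = i + \<beta> (k - i)" if "i \<le> k" "k < n" for k
    using \<gamma>\<beta>[of "k - i"] that by (simp add: n_def)
  have fin: "finite A" "finite B"
    by (rule finite_subset[of _ "{..<n} \<times> {..<n}"], use assms(1) in \<open>auto simp: A_def B_def n_def\<close>)+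
  have "{(a, b). a < b \<and> b < length ds \<and> \<gamma> b < \<gamma> a} = A \<union> ?sh ` B"
  proof (rule set_eqI, clarify)
    fix a b
    consider "b < i" | "a < i" "i \<le> b" | "i \<le> a" "i \<le> b" | "b \<le> a" by linarith
    then show "(a, b) \<in> {(a, b). a < b \<and> b < length ds \<and> \<gamma> b < \<gamma> a} \<longleftrightarrow> (a, b) \<in> A \<union> ?sh ` B"
    proof cases
      case 1
      then show ?thesis using assms(1) by (auto simp: A_def B_def \<gamma>\<alpha>)
    next
      case 2
      then show ?thesis
        using \<gamma>_sub[of b] \<alpha>_lt[of a] by (auto simp: A_def B_def n_def \<gamma>\<alpha>)
    next
      case 3
      have "(a, b) \<in> ?sh ` B \<longleftrightarrow> (a - i, b - i) \<in> B"
        using 3 by (force simp: image_iff)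
      then show ?thesis
        using 3 \<gamma>_sub[of b] \<gamma>_sub[of a] by (auto simp: A_def B_def n_def)
    next
      case 4
      then show ?thesis by (auto simp: A_def B_def)
    qed
  qed
  then have "koszul \<gamma> ds = (\<Prod>p\<in>A \<union> ?sh ` B. w p)"
    by (simp add: koszul_def w_def)
  also have "\<dots> = (\<Prod>p\<in>A. w p) * (\<Prod>p\<in>?sh ` B. w p)"
    by (rule prod.union_disjoint) (use fin in \<open>auto simp: A_def B_def\<close>)
  also have "(\<Prod>p\<in>?sh ` B. w p) = (\<Prod>p\<in>B. w (?sh p))"
    by (subst prod.reindex) (auto simp: inj_on_def)
  also have "\<dots> = koszul \<beta> (drop i ds)"
    unfolding koszul_def B_def n_def
    by (rule prod.cong) (use assms(1) in \<open>auto simp: w_def \<gamma>\<beta>\<close>)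
  also have "(\<Prod>p\<in>A. w p) = koszul \<alpha> (take i ds)"
    unfolding koszul_def A_def
    by (rule prod.cong) (use assms(1) \<alpha>_lt in \<open>auto simp: w_def \<gamma>\<alpha>\<close>)
  finally show ?thesis .
qed

text \<open>At the first disagreement the smaller of the two values must be taken by the other
  function at an earlier point; there both functions agree, which contradicts strict
  monotonicity.\<close>

lemma strict_mono_on_image_unique:
  fixes f g :: "nat \<Rightarrow> nat"
  assumes "strict_mono_on A f" "strict_mono_on A g" "f ` A = g ` A" "x \<in> A"
  shows "f x = g x"
  using assms(4)
proof (induction x rule: less_induct)
  case (less x)
  have *: "\<not> p x < q x"
    if mono: "strict_mono_on A p" "strict_mono_on A q" and im: "p ` A = q ` A"
      and eq: "\<And>y. y < x \<Longrightarrow> y \<in> A \<Longrightarrow> p y = q y"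
    for p q :: "nat \<Rightarrow> nat"
  proof
    assume lt: "p x < q x"
    obtain y where y: "y \<in> A" "q y = p x"
      using im less.prems by (metis image_iff)
    then have "y < x"
      using lt mono(2) less.prems by (metis linorder_neqE_nat order_less_asym strict_mono_onD)
    then show False
      using y mono(1) eq less.prems by (metis order_less_irrefl strict_mono_onD)
  qed
  show ?case
    using *[of f g] *[of g f] assms(1-3) less.IH by (metis linorder_neqE_nat)
qed

text \<open>A shuffle enumerates the image of each block in increasing order, so the image of the
  first block determines it. This identifies shuffles with cosets of
  \<open>S_i \<times> S_(n-i)\<close>.\<close>

lemma bij_betw_Sh_subsets:
  assumes "i \<le> n"
  shows "bij_betw (\<lambda>\<sigma>. \<sigma> ` {..<i}) (Sh i n) {A. A \<subseteq> {..<n} \<and> card A = i}"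
proof (rule bij_betwI')
  fix \<sigma> \<tau> assume \<sigma>: "\<sigma> \<in> Sh i n" and \<tau>: "\<tau> \<in> Sh i n"
  have compl: "\<pi> ` {i..<n} = {..<n} - \<pi> ` {..<i}" if "\<pi> permutes {..<n}" for \<pi>
  proof -
    have "{i..<n} = {..<n} - {..<i}" by auto
    then show ?thesis
      using permutes_image[OF that] inj_on_subset[OF permutes_inj[OF that]]
      by (metis image_set_diff permutes_inj that)
  qed
  show "\<sigma> ` {..<i} = \<tau> ` {..<i} \<longleftrightarrow> \<sigma> = \<tau>"
  proof
    assume eq: "\<sigma> ` {..<i} = \<tau> ` {..<i}"
    show "\<sigma> = \<tau>"
    proof
      fix k
      consider "k \<in> {..<i}" | "k \<in> {i..<n}" | "k \<notin> {..<n}" by force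
      then show "\<sigma> k = \<tau> k"
      proof cases
        case 1
        then show ?thesis
          using strict_mono_on_image_unique[OF _ _ eq] \<sigma> \<tau> by (auto simp: Sh_def)
      next
        case 2
        moreover have "\<sigma> ` {i..<n} = \<tau> ` {i..<n}"
          using eq compl \<sigma> \<tau> by (simp add: Sh_def)
        ultimately show ?thesis
          using strict_mono_on_image_unique[of "{i..<n}" \<sigma> \<tau> k] \<sigma> \<tau> by (auto simp: Sh_def)
      next
        case 3
        then show ?thesis using \<sigma> \<tau> unfolding Sh_def
          by (metis (mono_tags, lifting) mem_Collect_eq permutes_not_in)
      qed
    qed
  qed simp
next
  fix \<sigma> assume "\<sigma> \<in> Sh i n"
  then have \<sigma>: "\<sigma> permutes {..<n}" by (simp add: Sh_def)
  then have "card (\<sigma> ` {..<i}) = i"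
    using permutes_inj[OF \<sigma>] by (simp add: card_image inj_on_subset)
  moreover have "\<sigma> ` {..<i} \<subseteq> {..<n}"
    using assms permutes_image[OF \<sigma>] by auto
  ultimately show "\<sigma> ` {..<i} \<in> {A. A \<subseteq> {..<n} \<and> card A = i}" by simp
next
  fix A assume "A \<in> {A. A \<subseteq> {..<n} \<and> card A = i}"
  then have A: "A \<subseteq> {..<n}" "card A = i" by auto
  then have fin: "finite A" using finite_subset by blast
  define as where "as = sorted_list_of_set A"
  define bs where "bs = sorted_list_of_set ({..<n} - A)"
  have len: "length as = i" "length bs = n - i"
    using A fin by (simp_all add: as_def bs_def card_Diff_subset)
  have set: "set as = A" "set bs = {..<n} - A"
    using fin by (simp_all add: as_def bs_def)
  have sorted: "sorted_wrt (<) as" "sorted_wrt (<) bs"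
    by (simp_all add: as_def bs_def)
  \<comment> \<open>The preimage of \<open>A\<close> lists \<open>A\<close> and then its complement,
    both in increasing order; it is the identity from \<open>n\<close> on, as
    \<open>permutes\<close> demands.\<close>
  define \<sigma> where "\<sigma> k = (if k < n then (as @ bs) ! k else k)" for k
  have "distinct (as @ bs)"
    using set fin by (auto simp: as_def bs_def)
  moreover have "{..<n} = {..<length (as @ bs)}" "{..<n} = set (as @ bs)"
    using len set A assms by auto
  ultimately have "bij_betw ((!) (as @ bs)) {..<n} {..<n}"
    by (rule bij_betw_nth)
  then have "bij_betw \<sigma> {..<n} {..<n}"
    by (rule bij_betw_cong[THEN iffD1, rotated]) (simp add: \<sigma>_def)
  then have perm: "\<sigma> permutes {..<n}"
    by (rule bij_imp_permutes) (simp add: \<sigma>_def)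
  have \<sigma>_lo: "\<sigma> k = as ! k" if "k < i" for k
    using that assms len by (simp add: \<sigma>_def nth_append)
  have \<sigma>_hi: "\<sigma> k = bs ! (k - i)" if "i \<le> k" "k < n" for k
    using that len by (simp add: \<sigma>_def nth_append)
  have "strict_mono_on {..<i} \<sigma>"
    using sorted(1) len by (auto simp: strict_mono_on_def \<sigma>_lo sorted_wrt_iff_nth_less)
  moreover have "strict_mono_on {i..<n} \<sigma>"
    using sorted(2) len by (auto simp: strict_mono_on_def \<sigma>_hi sorted_wrt_iff_nth_less)
  ultimately have "\<sigma> \<in> Sh i n" using perm by (simp add: Sh_def)
  moreover have "A = \<sigma> ` {..<i}"
    using set(1) len(1) \<sigma>_lo by (auto simp: set_conv_nth)
  ultimately show "\<exists>\<sigma>\<in>Sh i n. A = \<sigma> ` {..<i}" by blast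
qed

text \<open>\<open>\<tau> \<circ> \<sigma>\<close> need not be a shuffle. A function that is
  constant on cosets descends to \<open>i\<close>-element subsets, however, and
  \<open>\<tau>\<close> permutes these.\<close>

lemma sum_Sh_left_translate:
  fixes T :: "(nat \<Rightarrow> nat) \<Rightarrow> 'b::comm_monoid_add"
  assumes "i \<le> n" and \<tau>: "\<tau> permutes {..<n}"
    and inv: "\<And>\<pi> \<pi>'. \<pi> permutes {..<n} \<Longrightarrow> \<pi>' permutes {..<n} \<Longrightarrow> \<pi> ` {..<i} = \<pi>' ` {..<i} \<Longrightarrow> T \<pi> = T \<pi>'"
  shows "(\<Sum>\<sigma>\<in>Sh i n. T (\<tau> \<circ> \<sigma>)) = (\<Sum>\<sigma>\<in>Sh i n. T \<sigma>)"
proof -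
  let ?S = "{A. A \<subseteq> {..<n} \<and> card A = i}"
  \<comment> \<open>\<open>U\<close> is the function induced by \<open>T\<close> on subsets; by the
    coset hypothesis the choice of representative does not matter.\<close>
  define U where "U A = T (SOME \<pi>. \<pi> permutes {..<n} \<and> \<pi> ` {..<i} = A)" for A
  have U: "T \<pi> = U (\<pi> ` {..<i})" if "\<pi> permutes {..<n}" for \<pi>
  proof -
    have "\<exists>\<pi>'. \<pi>' permutes {..<n} \<and> \<pi>' ` {..<i} = \<pi> ` {..<i}" using that by blast
    from someI_ex[OF this] show ?thesis
      unfolding U_def by (intro inv that) auto
  qed
  have perm: "\<sigma> permutes {..<n}" if "\<sigma> \<in> Sh i n" for \<sigma>
    using that by (simp add: Sh_def)
  have inj: "inj \<tau>" using \<tau> by (rule permutes_inj)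
  have \<tau>_bij: "bij_betw (image \<tau>) ?S ?S"
  proof (rule bij_betw_byWitness[where f' = "image (inv \<tau>)"])
    have *: "image \<rho> ` ?S \<subseteq> ?S" if "\<rho> permutes {..<n}" for \<rho>
      using permutes_image[OF that] permutes_inj[OF that]
      by (auto simp: card_image inj_on_subset)
    show "image \<tau> ` ?S \<subseteq> ?S" "image (inv \<tau>) ` ?S \<subseteq> ?S"
      using *[OF \<tau>] *[OF permutes_inv[OF \<tau>]] .
  qed (auto simp: image_image permutes_inverses[OF \<tau>])
  have "(\<Sum>\<sigma>\<in>Sh i n. T (\<tau> \<circ> \<sigma>)) = (\<Sum>\<sigma>\<in>Sh i n. U (\<tau> ` \<sigma> ` {..<i}))"
    by (rule sum.cong) (simp_all add: U permutes_compose[OF perm \<tau>] image_comp)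
  also have "\<dots> = (\<Sum>A\<in>?S. U (\<tau> ` A))"
    using bij_betw_Sh_subsets[OF assms(1)] by (rule sum.reindex_bij_betw)
  also have "\<dots> = (\<Sum>A\<in>?S. U A)"
    using \<tau>_bij by (rule sum.reindex_bij_betw)
  also have "\<dots> = (\<Sum>\<sigma>\<in>Sh i n. U (\<sigma> ` {..<i}))"
    using bij_betw_Sh_subsets[OF assms(1)] by (rule sum.reindex_bij_betw[symmetric])
  also have "\<dots> = (\<Sum>\<sigma>\<in>Sh i n. T \<sigma>)"
    by (rule sum.cong) (simp_all add: U perm)
  finally show ?thesis .
qed

section \<open>The coproduct and maps on the tensor square\<close>

lemma linear_on_zero:
  assumes "linear_on U s t f" "0 \<in> U"
  shows "f 0 = 0"
  using assms unfolding linear_on_def by (metis add_0 add_cancel_right_left)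

lemma linear_on_subset: "linear_on U s t f \<Longrightarrow> W \<subseteq> U \<Longrightarrow> linear_on W s t f"
  unfolding linear_on_def by (meson subset_iff)

lemma linear_on_compose:
  assumes "linear_on U s t f" "linear_on W t r g" "\<And>x. x \<in> U \<Longrightarrow> f x \<in> W"
  shows "linear_on U s r (\<lambda>x. g (f x))"
  using assms by (simp add: linear_on_def)

lemma linear_on_add:
  assumes "module t" "linear_on U s t f" "linear_on U s t g"
  shows "linear_on U s t (\<lambda>x. f x + g x)"
  using assms by (simp add: linear_on_def module.scale_right_distrib)

lemma linear_on_scale:
  assumes "module t" "linear_on U s t f"
  shows "linear_on U s t (\<lambda>x. t c (f x))"
  using assms by (simp add: linear_on_def module.scale_right_distrib module.scale_scale mult.commute)

lemma linear_on_sum: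
  assumes "module t" "\<And>i. i \<in> I \<Longrightarrow> linear_on U s t (f i)"
  shows "linear_on U s t (\<lambda>x. \<Sum>i\<in>I. f i x)"
  using assms by (simp add: linear_on_def sum.distrib module.scale_sum_right)

context vector_space
begin

lemma linear_on_span_eq:
  assumes f: "linear_on (span B) scale t f" and g: "linear_on (span B) scale t g"
    and eq: "\<And>b. b \<in> B \<Longrightarrow> f b = g b" and "x \<in> span B"
  shows "f x = g x"
proof -
  have "x \<in> span B \<and> f x = g x"
    using \<open>x \<in> span B\<close>
  proof (induction rule: span_induct_alt)
    case base
    show ?case
      using linear_on_zero[OF f] linear_on_zero[OF g] by (simp add: span_zero)
  next
    case (step c b y)
    then show ?case
      using f g eq by (simp add: linear_on_def span_base span_add span_scale)
  qed
  then show ?thesis by simp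
qed

lemma linear_on_span_image:
  assumes f: "linear_on (span B) scale t f" and t: "module t" and W: "module.subspace t W"
    and im: "\<And>b. b \<in> B \<Longrightarrow> f b \<in> W" and "x \<in> span B"
  shows "f x \<in> W"
proof -
  have "x \<in> span B \<and> f x \<in> W"
    using \<open>x \<in> span B\<close>
  proof (induction rule: span_induct_alt)
    case base
    show ?case
      using linear_on_zero[OF f] W by (simp add: span_zero module.subspace_0[OF t])
  next
    case (step c b y)
    then show ?case
      using f im module.subspace_add[OF t W] module.subspace_scale[OF t W]
      by (simp add: linear_on_def span_base span_add span_scale)
  qed
  then show ?thesis by simp
qed

end

interpretation fs: vector_space fscale
  by (rule vector_space_fscale)

section \<open>Homogeneous lists, and generators of the symmetric coalgebra and its tensor
  square\<close>

lemma homogeneous_permute_list: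
  assumes "homogeneous V ds xs" "\<sigma> permutes {..<length xs}"
  shows "homogeneous V (permute_list \<sigma> ds) (permute_list \<sigma> xs)"
proof -
  have "length ds = length xs"
    using assms(1) by (auto simp: homogeneous_def dest: list_all2_lengthD)
  then show ?thesis
    using assms by (simp add: homogeneous_def list_all2_permute_list_iff)
qed

lemma homogeneous_length: "homogeneous V ds xs \<Longrightarrow> length ds = length xs"
  by (auto simp: homogeneous_def dest: list_all2_lengthD)

lemma homogeneous_take: "homogeneous V ds xs \<Longrightarrow> homogeneous V (take i ds) (take i xs)"
  and homogeneous_drop: "homogeneous V ds xs \<Longrightarrow> homogeneous V (drop i ds) (drop i xs)"
  by (auto simp: homogeneous_def list_all2_takeI list_all2_dropI)

lemma homogeneous_nth: "homogeneous V ds xs \<Longrightarrow> i < length xs \<Longrightarrow> xs ! i \<in> V (ds ! i)"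
  by (auto simp: homogeneous_def list_all2_conv_all_nth)

lemma homogeneous_update:
  "homogeneous V ds xs \<Longrightarrow> x \<in> V (ds ! i) \<Longrightarrow> homogeneous V ds (xs[i := x])"
  by (cases "i < length xs") (auto simp: homogeneous_def list_all2_conv_all_nth nth_list_update)

text \<open>Transports multilinearity in position \<open>k\<close> through a permutation of the
  arguments.\<close>

lemma permute_list_update:
  assumes "\<sigma> permutes {..<length xs}" "k < length xs"
  shows "permute_list \<sigma> (xs[k := x]) = (permute_list \<sigma> xs)[inv \<sigma> k := x]"
proof (rule nth_equalityI)
  fix j assume "j < length (permute_list \<sigma> (xs[k := x]))"
  moreover have "\<sigma> j = k \<longleftrightarrow> j = inv \<sigma> k"
    using permutes_inverses[OF assms(1)] by metis
  ultimately show "permute_list \<sigma> (xs[k := x]) ! j = (permute_list \<sigma> xs)[inv \<sigma> k := x] ! j"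
    using assms by (auto simp: permute_list_nth nth_list_update)
qed simp

lemma subspace_SV: "fs.subspace (SV sc V)"
  and subspace_SV_deg: "fs.subspace (SV_deg sc V d)"
  and subspace_SV2: "fs.subspace (SV2 sc V)"
  unfolding SV_def SV_deg_def SV2_def by (rule fs.subspace_span)+

lemma smon_in_SV: "homogeneous V ds xs \<Longrightarrow> xs \<noteq> [] \<Longrightarrow> smon sc V xs \<in> SV sc V"
  unfolding SV_def by (rule fs.span_base) blast

lemma smon_in_SV_deg:
  "homogeneous V ds xs \<Longrightarrow> xs \<noteq> [] \<Longrightarrow> smon sc V xs \<in> SV_deg sc V (sum_list ds)"
  unfolding SV_deg_def by (rule fs.span_base) blast

lemma SV_linear_image:
  assumes "linear_on (SV sc V) fscale t f" "module t" "module.subspace t W"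
    and "\<And>ds xs. homogeneous V ds xs \<Longrightarrow> xs \<noteq> [] \<Longrightarrow> f (smon sc V xs) \<in> W"
    and "x \<in> SV sc V"
  shows "f x \<in> W"
  using assms(1-3) _ assms(5) unfolding SV_def
  by (rule fs.linear_on_span_image) (use assms(4) in blast)

lemma SV_deg_subset_SV: "SV_deg sc V d \<subseteq> SV sc V"
  unfolding SV_deg_def SV_def by (rule fs.span_mono) blast

lemma SV_span_SV_deg: "SV sc V = fs.span (\<Union>d. SV_deg sc V d)"
proof
  show "SV sc V \<subseteq> fs.span (\<Union>d. SV_deg sc V d)"
    unfolding SV_def[of sc V] by (rule fs.span_mono) (use smon_in_SV_deg in blast)
  show "fs.span (\<Union>d. SV_deg sc V d) \<subseteq> SV sc V"
    by (rule fs.span_minimal[OF _ subspace_SV]) (use SV_deg_subset_SV in blast)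
qed

lemma tens_in_SV2: "x \<in> SV sc V \<Longrightarrow> y \<in> SV sc V \<Longrightarrow> tens sc V x y \<in> SV2 sc V"
  unfolding SV2_def by (rule fs.span_base) blast

lemma linear_on_tens_left:
  "y \<in> SV sc V \<Longrightarrow> linear_on (SV sc V) fscale fscale (\<lambda>x. tens sc V x y)"
  and linear_on_tens_right:
  "x \<in> SV sc V \<Longrightarrow> linear_on (SV sc V) fscale fscale (\<lambda>y. tens sc V x y)"
  by (auto simp: linear_on_def tens_def bilinear_form_def fscale_def fun_eq_iff)

lemma tens_fscale:
  assumes "x \<in> SV sc V" "y \<in> SV sc V"
  shows "tens sc V (fscale a x) (fscale b y) = fscale (a * b) (tens sc V x y)"
proof -
  have "tens sc V (fscale a x) (fscale b y) = fscale a (tens sc V x (fscale b y))"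
    using linear_on_tens_left[of "fscale b y" sc V] assms fs.subspace_scale[OF subspace_SV[of sc V]]
    by (simp add: linear_on_def)
  then show ?thesis
    using linear_on_tens_right[of x sc V] assms by (simp add: linear_on_def)
qed

text \<open>\<open>tens_map\<close> is specified only on tensors whose left factor is homogeneous.
  Such tensors suffice: linearity in the left factor reaches all of \<open>SV\<close>, and linearity
  on the span of tensors does the rest.\<close>

lemma SV2_eqI:
  assumes F: "linear_on (SV2 sc V) fscale t F" and G: "linear_on (SV2 sc V) fscale t G"
    and eq: "\<And>a x y. x \<in> SV_deg sc V a \<Longrightarrow> y \<in> SV sc V \<Longrightarrow> F (tens sc V x y) = G (tens sc V x y)"
    and "z \<in> SV2 sc V"
  shows "F z = G z"
proof -
  have "F (tens sc V x y) = G (tens sc V x y)" if x: "x \<in> SV sc V" and y: "y \<in> SV sc V" for x y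
  proof (rule fs.linear_on_span_eq[where x = x and B = "\<Union>d. SV_deg sc V d" and t = t])
    show "x \<in> fs.span (\<Union>d. SV_deg sc V d)"
      using x by (simp add: SV_span_SV_deg[symmetric])
    show "linear_on (fs.span (\<Union>d. SV_deg sc V d)) fscale t (\<lambda>x. F (tens sc V x y))"
      unfolding SV_span_SV_deg[symmetric]
      by (rule linear_on_compose[OF linear_on_tens_left[OF y] F tens_in_SV2[OF _ y]])
    show "linear_on (fs.span (\<Union>d. SV_deg sc V d)) fscale t (\<lambda>x. G (tens sc V x y))"
      unfolding SV_span_SV_deg[symmetric]
      by (rule linear_on_compose[OF linear_on_tens_left[OF y] G tens_in_SV2[OF _ y]])
  qed (use eq y in blast)
  then show ?thesis
    using fs.linear_on_span_eq[OF F[unfolded SV2_def] G[unfolded SV2_def], of z] assms(4)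
    unfolding SV2_def by blast
qed

section \<open>Linear maps defined by their values on monomials\<close>

text \<open>What is kept of the grading is what makes signs well defined: the degree of a nonzero
  homogeneous vector is unique. The space \<open>V\<close> will be the desuspension of
  \<open>L\<close>.\<close>

locale graded = vector_space sc
  for sc :: "'k::field \<Rightarrow> 'a::ab_group_add \<Rightarrow> 'a" +
  fixes V :: "int \<Rightarrow> 'a set"
  assumes subspace_degree: "subspace (V d)"
    and degree_unique: "x \<in> V d \<Longrightarrow> x \<in> V e \<Longrightarrow> d \<noteq> e \<Longrightarrow> x = 0"
begin

text \<open>The function \<open>g\<close> sees a degree list, a \<open>sym_form\<close> does not. If
  two degree lists fit \<open>xs\<close> and differ at \<open>i\<close>, then \<open>xs ! i\<close>
  lies in two degrees and is 0, so multilinearity makes both values of \<open>g\<close>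
  vanish.\<close>

lemma sym_form_ex:
  fixes g :: "int list \<Rightarrow> 'a list \<Rightarrow> 'k"
  assumes lin: "\<And>ds xs i. homogeneous V ds xs \<Longrightarrow> i < length xs \<Longrightarrow>
      linear_on (V (ds ! i)) sc (*) (\<lambda>x. g ds (xs[i := x]))"
    and perm: "\<And>ds xs \<sigma>. homogeneous V ds xs \<Longrightarrow> \<sigma> permutes {..<length xs} \<Longrightarrow>
      g (permute_list \<sigma> ds) (permute_list \<sigma> xs) = koszul \<sigma> ds * g ds xs"
  shows "\<exists>\<phi>. sym_form sc V \<phi> \<and> (\<forall>ds xs. homogeneous V ds xs \<longrightarrow> \<phi> xs = g ds xs)"
proof -
  have zero: "g ds xs = 0" if "homogeneous V ds xs" "i < length xs" "xs ! i = 0" for ds xs i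
    using linear_on_zero[OF lin[OF that(1,2)] subspace_0[OF subspace_degree]] that(3)
    by (metis list_update_id)
  have indep: "g ds xs = g es xs" if ds: "homogeneous V ds xs" and es: "homogeneous V es xs" for ds es xs
  proof (cases "ds = es")
    case False
    have "length ds = length xs" "length es = length xs"
      using ds es by (auto dest: homogeneous_length)
    then obtain i where "i < length xs" "ds ! i \<noteq> es ! i"
      using False by (metis nth_equalityI)
    moreover from this have "xs ! i = 0"
      using degree_unique homogeneous_nth ds es by metis
    ultimately show ?thesis using zero ds es by metis
  qed simp
  define \<phi> where "\<phi> xs = g (SOME ds. homogeneous V ds xs) xs" for xs
  have \<phi>: "\<phi> xs = g ds xs" if "homogeneous V ds xs" for ds xs
    unfolding \<phi>_def by (rule indep[OF someI[of "\<lambda>ds. homogeneous V ds xs"] that]) (rule that)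
  have "linear_on (V (ds ! i)) sc (*) (\<lambda>x. \<phi> (xs[i := x]))"
    if "homogeneous V ds xs" "i < length xs" for ds xs i
    using lin[OF that] subspace_add[OF subspace_degree] subspace_scale[OF subspace_degree]
    by (simp add: linear_on_def \<phi>[OF homogeneous_update[OF that(1)]])
  moreover have "\<phi> (permute_list \<sigma> xs) = koszul \<sigma> ds * \<phi> xs"
    if "homogeneous V ds xs" "\<sigma> permutes {..<length xs}" for ds xs \<sigma>
    using perm[OF that] \<phi>[OF homogeneous_permute_list[OF that]] \<phi>[OF that(1)] by simp
  ultimately have "sym_form sc V \<phi>"
    unfolding sym_form_def by blast
  with \<phi> show ?thesis by blast
qed

text \<open>Turns the definite description in \<open>lin_ext\<close> into a usable map: each
  coordinate \<open>y\<close> of \<open>g\<close> gives a graded symmetric form, as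
  \<open>lin_ext_ex1\<close> requires.\<close>

lemma is_lin_ext_lin_ext:
  fixes g :: "int list \<Rightarrow> 'a list \<Rightarrow> 'x \<Rightarrow> 'k"
  assumes lin: "\<And>ds xs i. homogeneous V ds xs \<Longrightarrow> i < length xs \<Longrightarrow>
      linear_on (V (ds ! i)) sc fscale (\<lambda>x. g ds (xs[i := x]))"
    and perm: "\<And>ds xs \<sigma>. homogeneous V ds xs \<Longrightarrow> \<sigma> permutes {..<length xs} \<Longrightarrow>
      g (permute_list \<sigma> ds) (permute_list \<sigma> xs) = fscale (koszul \<sigma> ds) (g ds xs)"
  shows "is_lin_ext sc V g (lin_ext sc V g)"
proof -
  have "\<exists>\<phi>. sym_form sc V \<phi> \<and> (\<forall>ds xs. homogeneous V ds xs \<longrightarrow> xs \<noteq> [] \<longrightarrow> \<phi> xs = g ds xs y)" for y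
  proof -
    have "\<exists>\<phi>. sym_form sc V \<phi> \<and> (\<forall>ds xs. homogeneous V ds xs \<longrightarrow> \<phi> xs = g ds xs y)"
    proof (rule sym_form_ex)
      show "linear_on (V (ds ! i)) sc (*) (\<lambda>x. g ds (xs[i := x]) y)"
        if "homogeneous V ds xs" "i < length xs" for ds xs i
        using lin[OF that] by (simp add: linear_on_def fscale_def fun_eq_iff)
    qed (simp add: perm fscale_def)
    then show ?thesis by blast
  qed
  from theI'[OF lin_ext_ex1[OF this]] show ?thesis
    by (simp add: lin_ext_def)
qed

text \<open>The sign in \<open>f \<otimes> g\<close> depends on the degree of the left argument.
  This map makes the sign linear on all of \<open>SV\<close>; it exists because the total degree is
  invariant under permutations.\<close>

lemma parity_map_ex:
  "\<exists>\<tau>. linear_on (SV sc V) fscale fscale \<tau> \<and> (\<forall>x\<in>SV sc V. \<tau> x \<in> SV sc V) \<and>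
     (\<forall>a. \<forall>x\<in>SV_deg sc V a. \<tau> x = fscale ((-1) powi (q * a)) x)"
proof -
  define g :: "int list \<Rightarrow> 'a list \<Rightarrow> ('a, 'k) sym"
    where "g ds xs = fscale ((-1) powi (q * sum_list ds)) (smon sc V xs)" for ds xs
  have sum: "sum_list (permute_list \<sigma> ds) = sum_list ds"
    if "\<sigma> permutes {..<length ds}" for \<sigma> and ds :: "int list"
    using mset_permute_list[OF that] by (metis sum_mset_sum_list)
  have "is_lin_ext sc V g (lin_ext sc V g)"
  proof (rule is_lin_ext_lin_ext)
    fix ds xs i assume "homogeneous V ds xs" "i < length xs"
    then show "linear_on (V (ds ! i)) sc fscale (\<lambda>x. g ds (xs[i := x]))"
      unfolding g_def by (intro linear_on_scale fs.module_axioms smon_linear)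
  next
    fix ds xs \<sigma> assume "homogeneous V ds xs" "\<sigma> permutes {..<length xs}"
    then show "g (permute_list \<sigma> ds) (permute_list \<sigma> xs) = fscale (koszul \<sigma> ds) (g ds xs)"
      using homogeneous_length[of V ds xs]
      by (simp add: g_def sum smon_permute fs.scale_scale mult.commute)
  qed
  then have lin: "linear_on (SV sc V) fscale fscale (lin_ext sc V g)"
    and eq: "\<And>ds xs. homogeneous V ds xs \<Longrightarrow> xs \<noteq> [] \<Longrightarrow> lin_ext sc V g (smon sc V xs) = g ds xs"
    by (auto simp: is_lin_ext_def)
  have "lin_ext sc V g x \<in> SV sc V" if "x \<in> SV sc V" for x
    using lin fs.module_axioms subspace_SV _ that
    by (rule SV_linear_image) (simp add: eq g_def smon_in_SV fs.subspace_scale[OF subspace_SV])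
  moreover have "lin_ext sc V g x = fscale ((-1) powi (q * a)) x" if x: "x \<in> SV_deg sc V a" for a x
  proof -
    have lin_a: "linear_on (SV_deg sc V a) fscale fscale (lin_ext sc V g)"
      using lin SV_deg_subset_SV by (rule linear_on_subset)
    have scale_a: "linear_on (SV_deg sc V a) fscale fscale (fscale ((-1) powi (q * a)))"
      by (auto simp: linear_on_def fscale_def fun_eq_iff algebra_simps)
    show ?thesis
      by (rule fs.linear_on_span_eq[OF lin_a[unfolded SV_deg_def] scale_a[unfolded SV_deg_def] _
            x[unfolded SV_deg_def]]) (auto simp: eq g_def)
  qed
  ultimately show ?thesis using lin by blast
qed


text \<open>\<open>W\<close> is kept apart from \<open>V (ds ! i)\<close> so that the rule also
  applies when \<open>ds\<close> is a \<open>take\<close> or \<open>drop\<close> of the degree list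
  in the goal.\<close>

lemma linear_on_smon:
  assumes "homogeneous V ds xs" "i < length xs" "V (ds ! i) = W"
    and "linear_on (SV sc V) fscale t h"
  shows "linear_on W sc t (\<lambda>x. h (smon sc V (xs[i := x])))"
proof (rule linear_on_compose[OF _ assms(4)])
  show "linear_on W sc fscale (\<lambda>x. smon sc V (xs[i := x]))"
    using smon_linear[OF assms(1,2)] assms(3) by simp
  show "smon sc V (xs[i := x]) \<in> SV sc V" if "x \<in> W" for x
    using that assms(1-3) by (intro smon_in_SV[OF homogeneous_update]) auto
qed

section \<open>The coproduct as a well-defined map into the tensor square\<close>

definition split_tens :: "nat \<Rightarrow> 'a list \<Rightarrow> ('a, 'k) sym2" where
  "split_tens i xs = tens sc V (smon sc V (take i xs)) (smon sc V (drop i xs))"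

lemma linear_on_split_tens:
  assumes "homogeneous V ds xs" "j < length xs" "i \<in> {1..<length xs}"
  shows "linear_on (V (ds ! j)) sc fscale (\<lambda>x. split_tens i (xs[j := x]))"
proof (cases "j < i")
  case True
  have "length ds = length xs" by (rule homogeneous_length[OF assms(1)])
  then have "linear_on (V (ds ! j)) sc fscale
      (\<lambda>x. tens sc V (smon sc V ((take i xs)[j := x])) (smon sc V (drop i xs)))"
    using True assms
    by (intro linear_on_smon[OF homogeneous_take[OF assms(1)]]
          linear_on_tens_left smon_in_SV[OF homogeneous_drop[OF assms(1)]]) auto
  with True show ?thesis
    by (simp add: split_tens_def take_update_swap)
next
  case False
  have "length ds = length xs" by (rule homogeneous_length[OF assms(1)])
  then have "linear_on (V (ds ! j)) sc fscale
      (\<lambda>x. tens sc V (smon sc V (take i xs)) (smon sc V ((drop i xs)[j - i := x])))"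
    using False assms
    by (intro linear_on_smon[OF homogeneous_drop[OF assms(1)]]
          linear_on_tens_right smon_in_SV[OF homogeneous_take[OF assms(1)]]) auto
  with False show ?thesis
    by (simp add: split_tens_def drop_update_swap)
qed

text \<open>Here \<open>\<pi>' = \<pi> \<circ> \<gamma>\<close> where \<open>\<gamma>\<close>
  preserves the first \<open>i\<close> positions. The Koszul sign of \<open>\<gamma>\<close> is the
  product of the signs of its two blocks, and reordering inside the two tensor factors yields the
  same signs once more, so they cancel.\<close>

lemma split_tens_coset:
  assumes xs: "homogeneous V ds xs" and i: "i \<in> {1..<length xs}"
    and \<pi>: "\<pi> permutes {..<length xs}" and \<pi>': "\<pi>' permutes {..<length xs}"
    and im: "\<pi> ` {..<i} = \<pi>' ` {..<i}"
  shows "fscale (koszul \<pi> ds) (split_tens i (permute_list \<pi> xs)) =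
    fscale (koszul \<pi>' ds) (split_tens i (permute_list \<pi>' xs))"
proof -
  define \<gamma> where "\<gamma> = inv \<pi> \<circ> \<pi>'"
  define ys where "ys = permute_list \<pi> xs"
  define es where "es = permute_list \<pi> ds"
  have len: "length ds = length xs" by (rule homogeneous_length[OF xs])
  have ys: "homogeneous V es ys"
    unfolding ys_def es_def by (rule homogeneous_permute_list[OF xs \<pi>])
  have \<gamma>: "\<gamma> permutes {..<length xs}"
    unfolding \<gamma>_def by (rule permutes_compose[OF \<pi>' permutes_inv[OF \<pi>]])
  have \<pi>'_eq: "\<pi>' = \<pi> \<circ> \<gamma>"
    by (simp add: \<gamma>_def o_assoc permutes_inv_o[OF \<pi>])
  have "\<gamma> ` {..<i} = {..<i}"
    unfolding \<gamma>_def image_comp[symmetric] im[symmetric]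
    by (simp add: image_image permutes_inverses[OF \<pi>])
  moreover have i': "i \<le> length ys" using i by (simp add: ys_def)
  moreover have "\<gamma> permutes {..<length ys}" using \<gamma> by (simp add: ys_def)
  ultimately obtain \<alpha> \<beta> where \<alpha>: "\<alpha> permutes {..<i}" and \<beta>: "\<beta> permutes {..<length ys - i}"
    and blocks: "\<And>k. k < i \<Longrightarrow> \<gamma> k = \<alpha> k" "\<And>k. k < length ys - i \<Longrightarrow> \<gamma> (i + k) = i + \<beta> k"
    using permutes_blocks by metis
  have lens: "length es = length ys" by (simp add: es_def ys_def len)
  have "koszul \<pi>' ds = (koszul \<pi> ds * koszul \<gamma> es :: 'k)"
    using \<pi> \<gamma> by (simp only: \<pi>'_eq es_def koszul_compose len)
  then have "koszul \<pi>' ds = koszul \<pi> ds * (koszul \<alpha> (take i es) * koszul \<beta> (drop i es) :: 'k)"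
    by (simp only: koszul_blocks[of i es \<alpha> \<beta> \<gamma>, unfolded lens, OF i' \<alpha> \<beta> blocks])
  moreover have "split_tens i (permute_list \<pi>' xs) =
      tens sc V (smon sc V (permute_list \<alpha> (take i ys))) (smon sc V (permute_list \<beta> (drop i ys)))"
    using take_permute_list_blocks[OF i' \<alpha> \<beta> blocks] drop_permute_list_blocks[OF i' \<alpha> \<beta> blocks]
    by (simp add: split_tens_def \<pi>'_eq permute_list_compose[OF \<gamma>] ys_def)
  moreover have "\<dots> = fscale (koszul \<alpha> (take i es) * koszul \<beta> (drop i es)) (split_tens i ys)"
  proof -
    have "take i ys \<noteq> []" "drop i ys \<noteq> []"
      using i by (simp_all add: ys_def flip: length_0_conv)
    then have "smon sc V (take i ys) \<in> SV sc V" "smon sc V (drop i ys) \<in> SV sc V"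
      by (simp_all add: smon_in_SV[OF homogeneous_take[OF ys]] smon_in_SV[OF homogeneous_drop[OF ys]])
    moreover have "smon sc V (permute_list \<alpha> (take i ys)) =
        fscale (koszul \<alpha> (take i es)) (smon sc V (take i ys))"
      using \<alpha> i' by (intro smon_permute homogeneous_take ys) (simp add: min_absorb2)
    moreover have "smon sc V (permute_list \<beta> (drop i ys)) =
        fscale (koszul \<beta> (drop i es)) (smon sc V (drop i ys))"
      using \<beta> by (intro smon_permute homogeneous_drop ys) simp
    ultimately show ?thesis
      by (simp add: tens_fscale split_tens_def)
  qed
  ultimately show ?thesis
    using koszul_square[of \<alpha> "take i es", where 'k = 'k] koszul_square[of \<beta> "drop i es", where 'k = 'k]
    by (simp add: fs.scale_scale ys_def[symmetric] algebra_simps)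
qed

lemma is_lin_ext_coproduct:
  "is_lin_ext sc V (\<lambda>ds xs. \<Sum>i\<in>{1..<length xs}. \<Sum>\<sigma>\<in>Sh i (length xs).
     fscale (koszul \<sigma> ds) (split_tens i (permute_list \<sigma> xs))) (coproduct sc V)"
  unfolding coproduct_def split_tens_def[symmetric]
proof (rule is_lin_ext_lin_ext)
  fix ds xs k assume xs: "homogeneous V ds xs" and k: "k < length xs"
  have "linear_on (V (ds ! k)) sc fscale (\<lambda>x. split_tens i (permute_list \<sigma> (xs[k := x])))"
    if i: "i \<in> {1..<length xs}" and "\<sigma> \<in> Sh i (length xs)" for i \<sigma>
  proof -
    have \<sigma>: "\<sigma> permutes {..<length xs}"
      using that by (simp add: Sh_def)
    have len: "length ds = length xs" by (rule homogeneous_length[OF xs])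
    \<comment> \<open>The varied entry sits at position \<open>inv \<sigma> k\<close> of the
      permuted list and keeps its degree \<open>ds ! k\<close>.\<close>
    have "inv \<sigma> k < length xs"
      using k permutes_in_image[OF permutes_inv[OF \<sigma>], of k] by simp
    moreover have "permute_list \<sigma> ds ! inv \<sigma> k = ds ! k"
      using \<sigma> calculation by (simp add: permute_list_nth len permutes_inverses[OF \<sigma>])
    ultimately show ?thesis
      using linear_on_split_tens[OF homogeneous_permute_list[OF xs \<sigma>], of "inv \<sigma> k" i] i
      by (simp add: permute_list_update[OF \<sigma> k])
  qed
  then show "linear_on (V (ds ! k)) sc fscale
      (\<lambda>x. \<Sum>i\<in>{1..<length (xs[k := x])}. \<Sum>\<sigma>\<in>Sh i (length (xs[k := x])).
        fscale (koszul \<sigma> ds) (split_tens i (permute_list \<sigma> (xs[k := x]))))"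
    unfolding length_list_update by (intro linear_on_sum linear_on_scale fs.module_axioms)
next
  fix ds xs \<tau> assume xs: "homogeneous V ds xs" and \<tau>: "\<tau> permutes {..<length xs}"
  let ?T = "\<lambda>i \<pi>. fscale (koszul \<pi> ds) (split_tens i (permute_list \<pi> xs))"
  have len: "length ds = length xs" by (rule homogeneous_length[OF xs])
  have "(\<Sum>\<sigma>\<in>Sh i (length xs). fscale (koszul \<sigma> (permute_list \<tau> ds))
        (split_tens i (permute_list \<sigma> (permute_list \<tau> xs)))) =
      fscale (koszul \<tau> ds) (\<Sum>\<sigma>\<in>Sh i (length xs). ?T i \<sigma>)"
    if i: "i \<in> {1..<length xs}" for i
  proof -
    have "(\<Sum>\<sigma>\<in>Sh i (length xs). fscale (koszul \<sigma> (permute_list \<tau> ds))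
        (split_tens i (permute_list \<sigma> (permute_list \<tau> xs)))) =
      (\<Sum>\<sigma>\<in>Sh i (length xs). fscale (koszul \<tau> ds) (?T i (\<tau> \<circ> \<sigma>)))"
    \<comment> \<open>By \<open>koszul_compose\<close> the sign of
      \<open>\<tau> \<circ> \<sigma>\<close> contains that of \<open>\<tau>\<close>; multiplying by
      the latter again removes it.\<close>
    proof (rule sum.cong[OF refl])
      fix \<sigma> assume "\<sigma> \<in> Sh i (length xs)"
      then have \<sigma>: "\<sigma> permutes {..<length xs}" by (simp add: Sh_def)
      show "fscale (koszul \<sigma> (permute_list \<tau> ds)) (split_tens i (permute_list \<sigma> (permute_list \<tau> xs))) =
          fscale (koszul \<tau> ds) (?T i (\<tau> \<circ> \<sigma>))"
        using \<tau> \<sigma> koszul_square[of \<tau> ds, where 'k = 'k]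
        by (simp add: koszul_compose len permute_list_compose fs.scale_scale mult.assoc[symmetric])
    qed
    also have "\<dots> = fscale (koszul \<tau> ds) (\<Sum>\<sigma>\<in>Sh i (length xs). ?T i (\<tau> \<circ> \<sigma>))"
      by (rule fs.scale_sum_right[symmetric])
    also have "(\<Sum>\<sigma>\<in>Sh i (length xs). ?T i (\<tau> \<circ> \<sigma>)) = (\<Sum>\<sigma>\<in>Sh i (length xs). ?T i \<sigma>)"
      using i by (intro sum_Sh_left_translate \<tau> split_tens_coset[OF xs i]) auto
    finally show ?thesis .
  qed
  then show "(\<Sum>i\<in>{1..<length (permute_list \<tau> xs)}. \<Sum>\<sigma>\<in>Sh i (length (permute_list \<tau> xs)).
        fscale (koszul \<sigma> (permute_list \<tau> ds)) (split_tens i (permute_list \<sigma> (permute_list \<tau> xs)))) =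
      fscale (koszul \<tau> ds) (\<Sum>i\<in>{1..<length xs}. \<Sum>\<sigma>\<in>Sh i (length xs). ?T i \<sigma>)"
    by (simp add: fs.scale_sum_right)
qed

lemma linear_on_coproduct: "linear_on (SV sc V) fscale fscale (coproduct sc V)"
  using is_lin_ext_coproduct by (simp add: is_lin_ext_def)

lemma coproduct_in_SV2:
  assumes "x \<in> SV sc V"
  shows "coproduct sc V x \<in> SV2 sc V"
  using linear_on_coproduct fs.module_axioms subspace_SV2 _ assms
proof (rule SV_linear_image)
  fix ds xs assume xs: "homogeneous V ds xs" "xs \<noteq> []"
  have "split_tens i (permute_list \<sigma> xs) \<in> SV2 sc V"
    if "i \<in> {1..<length xs}" "\<sigma> \<in> Sh i (length xs)" for i \<sigma>
  proof -
    have h: "homogeneous V (permute_list \<sigma> ds) (permute_list \<sigma> xs)"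
      using that xs by (simp add: homogeneous_permute_list Sh_def)
    show ?thesis
      using that unfolding split_tens_def
      by (intro tens_in_SV2 smon_in_SV[OF homogeneous_take[OF h]] smon_in_SV[OF homogeneous_drop[OF h]])
         (auto simp flip: length_0_conv)
  qed
  then show "coproduct sc V (smon sc V xs) \<in> SV2 sc V"
    using is_lin_ext_coproduct xs
    by (auto simp: is_lin_ext_def
        intro!: fs.subspace_sum[OF subspace_SV2] fs.subspace_scale[OF subspace_SV2])
qed


section \<open>Tensor products of endomorphisms\<close>

text \<open>Values outside \<open>SV\<close> are left free, so that \<open>id\<close>, which does
  not follow the convention of extension by 0, is covered along with coderivations.\<close>

definition SV_endo :: "(('a, 'k) sym \<Rightarrow> ('a, 'k) sym) \<Rightarrow> bool" where
  "SV_endo f \<longleftrightarrow> linear_on (SV sc V) fscale fscale f \<and> (\<forall>x\<in>SV sc V. f x \<in> SV sc V)"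

lemma SV_endoD:
  assumes "SV_endo f" "x \<in> SV sc V"
  shows "f x \<in> SV sc V" "y \<in> SV sc V \<Longrightarrow> f (x + y) = f x + f y" "f (fscale c x) = fscale c (f x)"
  using assms by (auto simp: SV_endo_def linear_on_def)

lemma SV_endo_id: "SV_endo id"
  by (simp add: SV_endo_def linear_on_def)

lemma SV_endo_compose: "SV_endo f \<Longrightarrow> SV_endo g \<Longrightarrow> SV_endo (\<lambda>x. f (g x))"
  by (simp add: SV_endo_def linear_on_def)

lemma SV_endo_lincomb: "SV_endo f \<Longrightarrow> SV_endo g \<Longrightarrow> SV_endo (\<lambda>x. fscale c (f x) + g x)"
  unfolding SV_endo_def
  by (auto intro!: linear_on_add linear_on_scale fs.module_axioms
      fs.subspace_add[OF subspace_SV] fs.subspace_scale[OF subspace_SV])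

lemma SV_endo_zero: "SV_endo (\<lambda>_. 0)"
  by (auto simp: SV_endo_def linear_on_def intro: fs.subspace_0[OF subspace_SV])

text \<open>Existence comes from pulling bilinear forms back along \<open>f\<close> and
  \<open>g\<close>, with the sign absorbed by the parity map \<open>\<tau>\<close>; uniqueness is
  \<open>SV2_eqI\<close>.\<close>

lemma tens_map_ex1:
  assumes f: "SV_endo f" and g: "SV_endo g"
  shows "\<exists>!F.
     linear_on (SV2 sc V) fscale fscale F \<and>
     (\<forall>a. \<forall>x\<in>SV_deg sc V a. \<forall>y\<in>SV sc V.
        F (tens sc V x y) = fscale ((-1) powi (q * a)) (tens sc V (f x) (g y))) \<and>
     (\<forall>z. z \<notin> SV2 sc V \<longrightarrow> F z = 0)"
    (is "\<exists>!F. ?spec F")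
proof (rule ex_ex1I)
  obtain \<tau> where \<tau>_lin: "linear_on (SV sc V) fscale fscale \<tau>"
    and \<tau>_SV: "\<And>x. x \<in> SV sc V \<Longrightarrow> \<tau> x \<in> SV sc V"
    and \<tau>_deg: "\<And>a x. x \<in> SV_deg sc V a \<Longrightarrow> \<tau> x = fscale ((-1) powi (q * a)) x"
    using parity_map_ex[of q] by blast
  have f\<tau>: "SV_endo (\<lambda>x. f (\<tau> x))"
    by (rule SV_endo_compose[OF f]) (use \<tau>_lin \<tau>_SV in \<open>simp add: SV_endo_def\<close>)
  \<comment> \<open>The pulled-back form must be bilinear itself, since \<open>tens\<close> returns
    0 on every other argument.\<close>
  have bil: "bilinear_form sc V (\<lambda>x y. \<beta> (f (\<tau> x)) (g y))" if "bilinear_form sc V \<beta>" for \<beta>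
    using that SV_endoD[OF f\<tau>] SV_endoD[OF g]
    by (simp add: bilinear_form_def linear_on_def)
  define F where "F z = (if z \<in> SV2 sc V
      then \<lambda>\<beta>. if bilinear_form sc V \<beta> then z (\<lambda>x y. \<beta> (f (\<tau> x)) (g y)) else 0 else 0)"
    for z :: "('a, 'k) sym2"
  have "linear_on (SV2 sc V) fscale fscale F"
    by (simp add: linear_on_def F_def fs.subspace_add[OF subspace_SV2] fs.subspace_scale[OF subspace_SV2])
       (auto simp: fscale_def fun_eq_iff)
  moreover have "F (tens sc V x y) = fscale ((-1) powi (q * a)) (tens sc V (f x) (g y))"
    if x: "x \<in> SV_deg sc V a" and y: "y \<in> SV sc V" for a x y
  proof
    fix \<beta>
    have x': "x \<in> SV sc V" using x SV_deg_subset_SV by blast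
    then have "f (\<tau> x) = fscale ((-1) powi (q * a)) (f x)"
      using \<tau>_deg[OF x] SV_endoD(3)[OF f] by simp
    then have "\<beta> (f (\<tau> x)) (g y) = (-1) powi (q * a) * \<beta> (f x) (g y)" if "bilinear_form sc V \<beta>"
      using that SV_endoD(1)[OF f x'] SV_endoD(1)[OF g y]
      by (simp add: bilinear_form_def linear_on_def)
    moreover have "F (tens sc V x y) \<beta> =
        (if bilinear_form sc V \<beta> then tens sc V x y (\<lambda>x y. \<beta> (f (\<tau> x)) (g y)) else 0)"
      using tens_in_SV2[OF x' y] by (simp add: F_def)
    ultimately show "F (tens sc V x y) \<beta> = fscale ((-1) powi (q * a)) (tens sc V (f x) (g y)) \<beta>"
      by (simp add: tens_def fscale_def bil)
  qed
  ultimately have "?spec F" by (simp add: F_def)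
  then show "\<exists>F. ?spec F" by blast
next
  fix F G assume F: "?spec F" and G: "?spec G"
  show "F = G"
  proof
    fix z
    show "F z = G z"
    proof (cases "z \<in> SV2 sc V")
      case True
      then show ?thesis
        by (rule SV2_eqI[rotated 3]) (use F G in auto)
    qed (use F G in auto)
  qed
qed

context
  fixes f g :: "('a, 'k) sym \<Rightarrow> ('a, 'k) sym" and q :: int
  assumes f: "SV_endo f" and g: "SV_endo g"
begin

lemma linear_on_tens_map: "linear_on (SV2 sc V) fscale fscale (tens_map sc V q f g)"
  and tens_map_tens: "x \<in> SV_deg sc V a \<Longrightarrow> y \<in> SV sc V \<Longrightarrow>
    tens_map sc V q f g (tens sc V x y) = fscale ((-1) powi (q * a)) (tens sc V (f x) (g y))"
  using theI'[OF tens_map_ex1[OF f g, of q]] unfolding tens_map_def[symmetric] by blast+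

lemma tens_map_in_SV2:
  assumes "z \<in> SV2 sc V"
  shows "tens_map sc V q f g z \<in> SV2 sc V"
proof -
  have tens: "tens_map sc V q f g (tens sc V x y) \<in> SV2 sc V"
    if x: "x \<in> SV sc V" and y: "y \<in> SV sc V" for x y
  proof -
    have "linear_on (SV sc V) fscale fscale (\<lambda>x. tens_map sc V q f g (tens sc V x y))"
      by (rule linear_on_compose[OF linear_on_tens_left[OF y] linear_on_tens_map tens_in_SV2[OF _ y]])
    then show ?thesis
      using fs.module_axioms subspace_SV2 _ x
    proof (rule SV_linear_image)
      fix ds xs assume xs: "homogeneous V ds xs" "xs \<noteq> []"
      show "tens_map sc V q f g (tens sc V (smon sc V xs) y) \<in> SV2 sc V"
        unfolding tens_map_tens[OF smon_in_SV_deg[OF xs] y]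
        by (intro fs.subspace_scale[OF subspace_SV2] tens_in_SV2 SV_endoD(1)[OF f]
              SV_endoD(1)[OF g] smon_in_SV[OF xs] y)
    qed
  qed
  show ?thesis
    by (rule fs.linear_on_span_image[OF linear_on_tens_map[unfolded SV2_def] fs.module_axioms
          subspace_SV2 _ assms[unfolded SV2_def]]) (use tens in blast)
qed

end

lemma tens_map_add:
  assumes "SV_endo f" "SV_endo g" "z \<in> SV2 sc V" "w \<in> SV2 sc V"
  shows "tens_map sc V q f g (z + w) = tens_map sc V q f g z + tens_map sc V q f g w"
  using linear_on_tens_map[OF assms(1,2), of q] assms(3,4) by (simp add: linear_on_def)

text \<open>The Koszul rule for composites. On a left factor of degree \<open>a\<close> the
  exponents \<open>q' * a\<close> and \<open>q * (a + m)\<close> add up; the excess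
  \<open>q * m\<close> comes from moving \<open>g\<close> past \<open>f'\<close>.\<close>

lemma tens_map_compose:
  assumes f: "SV_endo f" and g: "SV_endo g" and f': "SV_endo f'" and g': "SV_endo g'"
    and deg: "\<And>a x. x \<in> SV_deg sc V a \<Longrightarrow> f' x \<in> SV_deg sc V (a + m)"
    and z: "z \<in> SV2 sc V"
  shows "tens_map sc V q f g (tens_map sc V q' f' g' z) =
    fscale ((-1) powi (q * m)) (tens_map sc V (q + q') (\<lambda>x. f (f' x)) (\<lambda>x. g (g' x)) z)"
proof -
  have ff': "SV_endo (\<lambda>x. f (f' x))" and gg': "SV_endo (\<lambda>x. g (g' x))"
    using SV_endo_compose f g f' g' by blast+
  have lin: "linear_on (SV2 sc V) fscale fscale (\<lambda>z. tens_map sc V q f g (tens_map sc V q' f' g' z))"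
    using linear_on_tens_map[OF f' g', of q'] linear_on_tens_map[OF f g, of q]
    by (simp add: linear_on_def tens_map_in_SV2 f' g')
  have lin': "linear_on (SV2 sc V) fscale fscale (\<lambda>z. fscale ((-1) powi (q * m))
      (tens_map sc V (q + q') (\<lambda>x. f (f' x)) (\<lambda>x. g (g' x)) z))"
    by (rule linear_on_scale[OF fs.module_axioms linear_on_tens_map[OF ff' gg']])
  show ?thesis
  proof (rule SV2_eqI[OF lin lin' _ z])
    fix a x y assume x: "x \<in> SV_deg sc V a" and y: "y \<in> SV sc V"
    have x': "x \<in> SV sc V" using x SV_deg_subset_SV by blast
    have "tens sc V (f' x) (g' y) \<in> SV2 sc V"
      by (intro tens_in_SV2 SV_endoD(1)[OF f'] SV_endoD(1)[OF g'] x' y)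
    then have "tens_map sc V q f g (tens_map sc V q' f' g' (tens sc V x y)) =
        fscale ((-1) powi (q' * a)) (tens_map sc V q f g (tens sc V (f' x) (g' y)))"
      using linear_on_tens_map[OF f g, of q] by (simp add: tens_map_tens[OF f' g' x y] linear_on_def)
    also have "\<dots> = fscale ((-1) powi (q' * a) * (-1) powi (q * (a + m)))
        (tens sc V (f (f' x)) (g (g' y)))"
      by (simp add: tens_map_tens[OF f g deg[OF x] SV_endoD(1)[OF g' y]])
    also have "(-1) powi (q' * a) * (-1) powi (q * (a + m)) =
        (-1) powi (q * m) * (-1 :: 'k) powi ((q + q') * a)"
      by (simp add: power_int_add[symmetric] algebra_simps)
    finally show "tens_map sc V q f g (tens_map sc V q' f' g' (tens sc V x y)) =
        fscale ((-1) powi (q * m)) (tens_map sc V (q + q') (\<lambda>x. f (f' x)) (\<lambda>x. g (g' x)) (tens sc V x y))"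
      by (simp add: tens_map_tens[OF ff' gg' x y])
  qed
qed

lemma tens_map_lincomb_left:
  assumes f: "SV_endo f" and f': "SV_endo f'" and g: "SV_endo g" and z: "z \<in> SV2 sc V"
  shows "tens_map sc V q (\<lambda>x. fscale c (f x) + f' x) g z =
    fscale c (tens_map sc V q f g z) + tens_map sc V q f' g z"
proof (rule SV2_eqI[OF linear_on_tens_map[OF SV_endo_lincomb[OF f f'] g] _ _ z])
  show "linear_on (SV2 sc V) fscale fscale
      (\<lambda>z. fscale c (tens_map sc V q f g z) + tens_map sc V q f' g z)"
    by (intro linear_on_add linear_on_scale linear_on_tens_map f f' g fs.module_axioms)
  fix a x y assume x: "x \<in> SV_deg sc V a" and y: "y \<in> SV sc V"
  then have x': "x \<in> SV sc V" using SV_deg_subset_SV by blast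
  have "tens sc V (fscale c (f x) + f' x) (g y) =
      fscale c (tens sc V (f x) (g y)) + tens sc V (f' x) (g y)"
    using linear_on_tens_left[OF SV_endoD(1)[OF g y]] SV_endoD(1)[OF f x'] SV_endoD(1)[OF f' x']
    by (simp add: linear_on_def fs.subspace_scale[OF subspace_SV])
  then show "tens_map sc V q (\<lambda>x. fscale c (f x) + f' x) g (tens sc V x y) =
      fscale c (tens_map sc V q f g (tens sc V x y)) + tens_map sc V q f' g (tens sc V x y)"
    by (simp add: tens_map_tens[OF _ _ x y] SV_endo_lincomb f f' g fs.scale_right_distrib mult.commute)
qed

lemma tens_map_lincomb_right:
  assumes f: "SV_endo f" and g: "SV_endo g" and g': "SV_endo g'" and z: "z \<in> SV2 sc V"
  shows "tens_map sc V q f (\<lambda>x. fscale c (g x) + g' x) z =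
    fscale c (tens_map sc V q f g z) + tens_map sc V q f g' z"
proof (rule SV2_eqI[OF linear_on_tens_map[OF f SV_endo_lincomb[OF g g']] _ _ z])
  show "linear_on (SV2 sc V) fscale fscale
      (\<lambda>z. fscale c (tens_map sc V q f g z) + tens_map sc V q f g' z)"
    by (intro linear_on_add linear_on_scale linear_on_tens_map f g g' fs.module_axioms)
  fix a x y assume x: "x \<in> SV_deg sc V a" and y: "y \<in> SV sc V"
  then have x': "x \<in> SV sc V" using SV_deg_subset_SV by blast
  have "tens sc V (f x) (fscale c (g y) + g' y) =
      fscale c (tens sc V (f x) (g y)) + tens sc V (f x) (g' y)"
    using linear_on_tens_right[OF SV_endoD(1)[OF f x']] SV_endoD(1)[OF g y] SV_endoD(1)[OF g' y]
    by (simp add: linear_on_def fs.subspace_scale[OF subspace_SV])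
  then show "tens_map sc V q f (\<lambda>x. fscale c (g x) + g' x) (tens sc V x y) =
      fscale c (tens_map sc V q f g (tens sc V x y)) + tens_map sc V q f g' (tens sc V x y)"
    by (simp add: tens_map_tens[OF _ _ x y] SV_endo_lincomb f g g' fs.scale_right_distrib mult.commute)
qed

end

section \<open>Coderivations are closed under the commutator\<close>

context graded
begin

lemma CoderD:
  assumes "D \<in> Coder sc V n"
  shows "linear_on (SV sc V) fscale fscale D"
    and "x \<notin> SV sc V \<Longrightarrow> D x = 0"
    and "x \<in> SV_deg sc V d \<Longrightarrow> D x \<in> SV_deg sc V (d + n)"
    and "x \<in> SV sc V \<Longrightarrow> coproduct sc V (D x) =
        tens_map sc V 0 D id (coproduct sc V x) + tens_map sc V n id D (coproduct sc V x)"
  using assms unfolding Coder_def by blast+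

text \<open>The degree condition already sends every monomial into \<open>SV\<close>.\<close>

lemma Coder_SV_endo:
  assumes D: "D \<in> Coder sc V n"
  shows "SV_endo D"
  unfolding SV_endo_def
proof (intro conjI ballI)
  fix x assume "x \<in> SV sc V"
  then show "D x \<in> SV sc V"
  proof (rule SV_linear_image[OF CoderD(1)[OF D] fs.module_axioms subspace_SV, rotated])
    fix ds xs assume "homogeneous V ds xs" "xs \<noteq> []"
    then show "D (smon sc V xs) \<in> SV sc V"
      using CoderD(3)[OF D smon_in_SV_deg] SV_deg_subset_SV[of sc V "sum_list ds + n"] by blast
  qed
qed (rule CoderD(1)[OF D])

lemma Coder_lincomb:
  assumes D: "D \<in> Coder sc V n" and E: "E \<in> Coder sc V n"
  shows "(\<lambda>x. fscale c (D x) + E x) \<in> Coder sc V n"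
  unfolding Coder_def mem_Collect_eq
proof (intro conjI allI ballI impI)
  note endo = Coder_SV_endo[OF D] Coder_SV_endo[OF E]
  show "linear_on (SV sc V) fscale fscale (\<lambda>x. fscale c (D x) + E x)"
    using SV_endo_lincomb[OF endo] by (simp add: SV_endo_def)
  show "fscale c (D x) + E x = 0" if "x \<notin> SV sc V" for x
    using CoderD(2)[OF D that] CoderD(2)[OF E that] by simp
  show "fscale c (D x) + E x \<in> SV_deg sc V (d + n)" if "x \<in> SV_deg sc V d" for d x
    using CoderD(3)[OF D that] CoderD(3)[OF E that]
    by (intro fs.subspace_add[OF subspace_SV_deg] fs.subspace_scale[OF subspace_SV_deg])
  fix x assume x: "x \<in> SV sc V"
  have "coproduct sc V (fscale c (D x) + E x) = fscale c (coproduct sc V (D x)) + coproduct sc V (E x)"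
    using linear_on_coproduct SV_endoD(1)[OF endo(1) x] SV_endoD(1)[OF endo(2) x]
    by (simp add: linear_on_def fs.subspace_scale[OF subspace_SV])
  then show "coproduct sc V (fscale c (D x) + E x) =
      tens_map sc V 0 (\<lambda>x. fscale c (D x) + E x) id (coproduct sc V x) +
      tens_map sc V n id (\<lambda>x. fscale c (D x) + E x) (coproduct sc V x)"
    using coproduct_in_SV2[OF x]
    by (simp add: tens_map_lincomb_left tens_map_lincomb_right endo SV_endo_id
        CoderD(4)[OF D x] CoderD(4)[OF E x] fs.scale_right_distrib)
qed

lemma zero_in_Coder: "0 \<in> Coder sc V n"
proof -
  have zero: "tens_map sc V q f g z = 0"
    if "SV_endo f" "SV_endo g" "f = 0 \<or> g = 0" "z \<in> SV2 sc V" for q f g z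
  proof (rule SV2_eqI[OF linear_on_tens_map[OF that(1,2)] _ _ that(4)])
    show "linear_on (SV2 sc V) fscale fscale (\<lambda>_. 0)"
      by (simp add: linear_on_def)
    have "0 \<in> SV sc V" by (rule fs.subspace_0[OF subspace_SV])
    then have "tens sc V 0 y = 0" "tens sc V y 0 = 0" if "y \<in> SV sc V" for y
      using linear_on_zero[OF linear_on_tens_left[OF that]]
        linear_on_zero[OF linear_on_tens_right[OF that]] by auto
    then show "tens_map sc V q f g (tens sc V x y) = 0"
      if "x \<in> SV_deg sc V a" "y \<in> SV sc V" for a x y
      using that SV_deg_subset_SV[of sc V a] \<open>f = 0 \<or> g = 0\<close>
        SV_endoD(1)[OF \<open>SV_endo f\<close>] SV_endoD(1)[OF \<open>SV_endo g\<close>]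
      by (auto simp: tens_map_tens[OF \<open>SV_endo f\<close> \<open>SV_endo g\<close> that])
  qed
  have endo: "SV_endo 0"
    using SV_endo_zero by (simp add: zero_fun_def)
  then have "linear_on (SV sc V) fscale fscale (0 :: ('a, 'k) sym_map)"
    by (simp add: SV_endo_def)
  then show ?thesis
    using linear_on_zero[OF linear_on_coproduct fs.subspace_0[OF subspace_SV]]
      zero[OF endo SV_endo_id] zero[OF SV_endo_id endo]
    by (simp add: Coder_def coproduct_in_SV2 fs.subspace_0[OF subspace_SV_deg])
qed

text \<open>The coproduct of a composite has two derivation terms and two mixed terms. The mixed
  terms of \<open>D \<circ> E\<close> cancel against those of \<open>E \<circ> D\<close>, because
  the commutator sign squares to 1.\<close>

lemma commutator_in_Coder:
  assumes D: "D \<in> Coder sc V m" and E: "E \<in> Coder sc V n"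
  shows "commutator m n D E \<in> Coder sc V (m + n)"
proof -
  note dD = Coder_SV_endo[OF D] and dE = Coder_SV_endo[OF E]
  note DE = SV_endo_compose[OF dD dE] and ED = SV_endo_compose[OF dE dD]
  define s :: 'k where "s = (-1) powi (m * n)"
  have s: "s * s = 1" by (simp add: s_def minus_one_powi_square)
  \<comment> \<open>The form of a linear combination matches the \<open>lincomb\<close> rules for
    \<open>tens_map\<close>.\<close>
  have comm: "commutator m n D E = (\<lambda>x. fscale (- s) (E (D x)) + D (E x))"
    by (simp add: commutator_def s_def fs.scale_minus_left)
  \<comment> \<open>Applying the coderivation rule to \<open>A\<close> and then to \<open>B\<close>
    gives four composites of tensor maps; only the one in which \<open>A\<close> moves past
    \<open>B\<close> acquires a sign.\<close>
  have expand: "coproduct sc V (A (B x)) =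
      tens_map sc V 0 (\<lambda>x. A (B x)) id (coproduct sc V x) +
      tens_map sc V b A B (coproduct sc V x) +
      fscale ((-1) powi (a * b)) (tens_map sc V a B A (coproduct sc V x)) +
      tens_map sc V (a + b) id (\<lambda>x. A (B x)) (coproduct sc V x)"
    if A: "A \<in> Coder sc V a" and B: "B \<in> Coder sc V b" and x: "x \<in> SV sc V" for A B a b x
  proof -
    note dA = Coder_SV_endo[OF A] and dB = Coder_SV_endo[OF B]
    have w: "coproduct sc V x \<in> SV2 sc V" by (rule coproduct_in_SV2[OF x])
    have deg_id: "id y \<in> SV_deg sc V (d + 0)" if "y \<in> SV_deg sc V d" for y d
      using that by simp
    have "tens_map sc V 0 A id (tens_map sc V 0 B id (coproduct sc V x)) =
        tens_map sc V 0 (\<lambda>x. A (B x)) id (coproduct sc V x)"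
      using tens_map_compose[OF dA SV_endo_id dB SV_endo_id CoderD(3)[OF B] w, of 0 0]
      by (simp add: id_def)
    moreover have "tens_map sc V 0 A id (tens_map sc V b id B (coproduct sc V x)) =
        tens_map sc V b A B (coproduct sc V x)"
      using tens_map_compose[OF dA SV_endo_id SV_endo_id dB deg_id w, of 0 b]
      by (simp add: id_def)
    moreover have "tens_map sc V a id A (tens_map sc V 0 B id (coproduct sc V x)) =
        fscale ((-1) powi (a * b)) (tens_map sc V a B A (coproduct sc V x))"
      using tens_map_compose[OF SV_endo_id dA dB SV_endo_id CoderD(3)[OF B] w, of a 0]
      by (simp add: id_def)
    moreover have "tens_map sc V a id A (tens_map sc V b id B (coproduct sc V x)) =
        tens_map sc V (a + b) id (\<lambda>x. A (B x)) (coproduct sc V x)"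
      using tens_map_compose[OF SV_endo_id dA SV_endo_id dB deg_id w, of a b]
      by (simp add: id_def)
    ultimately show ?thesis
      using w by (simp add: CoderD(4)[OF A SV_endoD(1)[OF dB x]] CoderD(4)[OF B x]
          tens_map_add tens_map_in_SV2 dA dB SV_endo_id)
  qed
  show ?thesis
    unfolding Coder_def mem_Collect_eq comm
  proof (intro conjI allI ballI impI)
    show "linear_on (SV sc V) fscale fscale (\<lambda>x. fscale (- s) (E (D x)) + D (E x))"
      using SV_endo_lincomb[OF ED DE, of "- s"] unfolding SV_endo_def by blast
    \<comment> \<open>Off \<open>SV\<close> the inner map returns 0, which belongs to
      \<open>SV\<close>; the outer map then has to vanish at 0.\<close>
    have "E 0 = 0" "D 0 = 0"
      using dD dE linear_on_zero[OF _ fs.subspace_0[OF subspace_SV]] by (auto simp: SV_endo_def)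
    then show "fscale (- s) (E (D x)) + D (E x) = 0" if "x \<notin> SV sc V" for x
      using CoderD(2)[OF D that] CoderD(2)[OF E that] by simp
    show "fscale (- s) (E (D x)) + D (E x) \<in> SV_deg sc V (d + (m + n))" if "x \<in> SV_deg sc V d" for d x
      using CoderD(3)[OF D CoderD(3)[OF E that]] CoderD(3)[OF E CoderD(3)[OF D that]]
      by (intro fs.subspace_add[OF subspace_SV_deg] fs.subspace_scale[OF subspace_SV_deg])
         (simp_all add: ac_simps)
    fix x assume x: "x \<in> SV sc V"
    let ?w = "coproduct sc V x"
    have "coproduct sc V (fscale (- s) (E (D x)) + D (E x)) =
        fscale (- s) (coproduct sc V (E (D x))) + coproduct sc V (D (E x))"
      using linear_on_coproduct SV_endoD(1)[OF ED x] SV_endoD(1)[OF DE x]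
      by (simp add: linear_on_def fs.subspace_scale[OF subspace_SV] del: fs.scale_minus_left)
    also have "\<dots> =
        fscale (- s) (tens_map sc V 0 (\<lambda>x. E (D x)) id ?w) + tens_map sc V 0 (\<lambda>x. D (E x)) id ?w +
        (fscale (- s) (tens_map sc V (m + n) id (\<lambda>x. E (D x)) ?w) +
         tens_map sc V (m + n) id (\<lambda>x. D (E x)) ?w)"
      unfolding expand[OF D E x] expand[OF E D x]
        mult.commute[of n m] add.commute[of n m] s_def[symmetric]
      by (simp add: fs.scale_right_distrib s fs.scale_minus_left)
    also have "\<dots> = tens_map sc V 0 (\<lambda>x. fscale (- s) (E (D x)) + D (E x)) id ?w +
        tens_map sc V (m + n) id (\<lambda>x. fscale (- s) (E (D x)) + D (E x)) ?w"
      using coproduct_in_SV2[OF x]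
      by (simp add: tens_map_lincomb_left tens_map_lincomb_right DE ED SV_endo_id
          del: fs.scale_minus_left)
    finally show "coproduct sc V (fscale (- s) (E (D x)) + D (E x)) = \<dots>" .
  qed
qed

end

section \<open>Brackets as convolutions\<close>

definition antidiagonal :: "nat \<Rightarrow> (nat \<times> nat) set" where
  "antidiagonal n = {(i, j). i + j = n}"

lemma finite_antidiagonal [simp]: "finite (antidiagonal n)"
  by (rule finite_subset[of _ "{..n} \<times> {..n}"]) (auto simp: antidiagonal_def)

lemma sum_antidiagonal_swap:
  "(\<Sum>(i, j)\<in>antidiagonal n. f i j) = (\<Sum>(i, j)\<in>antidiagonal n. f j i)"
  by (rule sum.reindex_bij_witness[where i = prod.swap and j = prod.swap])
     (auto simp: antidiagonal_def)

text \<open>Both sides sum over all triples with total \<open>n\<close>, grouped once to the right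
  and once to the left.\<close>

lemma sum_antidiagonal_assoc:
  "(\<Sum>(i, j)\<in>antidiagonal n. \<Sum>(k, l)\<in>antidiagonal j. f i k l) =
    (\<Sum>(i, j)\<in>antidiagonal n. \<Sum>(k, l)\<in>antidiagonal i. f k l j)"
proof -
  have "(\<Sum>(i, j)\<in>antidiagonal n. \<Sum>(k, l)\<in>antidiagonal j. f i k l) =
      (\<Sum>((i, j), (k, l))\<in>(SIGMA p:antidiagonal n. antidiagonal (snd p)). f i k l)"
    by (subst sum.Sigma[symmetric]) (auto simp: case_prod_beta)
  also have "\<dots> = (\<Sum>((i, j), (k, l))\<in>(SIGMA p:antidiagonal n. antidiagonal (fst p)). f k l j)"
    by (rule sum.reindex_bij_witness
          [where j = "\<lambda>((i, j), (k, l)). ((i + k, l), (i, k))"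
             and i = "\<lambda>((i, j), (k, l)). ((k, l + j), (l, j))"])
       (auto simp: antidiagonal_def)
  also have "\<dots> = (\<Sum>(i, j)\<in>antidiagonal n. \<Sum>(k, l)\<in>antidiagonal i. f k l j)"
    by (subst sum.Sigma[symmetric]) (auto simp: case_prod_beta)
  finally show ?thesis .
qed

text \<open>Serves two purposes below: isolating the one surviving term at order
  \<open>N + 1\<close>, and shifting component indices by one.\<close>

lemma sum_antidiagonal_Suc_right:
  "(\<Sum>(i, j)\<in>antidiagonal (Suc n). f i j) = f (Suc n) 0 + (\<Sum>(i, j)\<in>antidiagonal n. f i (Suc j))"
proof -
  have "antidiagonal (Suc n) = insert (Suc n, 0) ((\<lambda>(i, j). (i, Suc j)) ` antidiagonal n)"
  proof (rule set_eqI, clarify)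
    fix i j
    show "(i, j) \<in> antidiagonal (Suc n) \<longleftrightarrow>
        (i, j) \<in> insert (Suc n, 0) ((\<lambda>(i, j). (i, Suc j)) ` antidiagonal n)"
      by (cases j) (auto simp: antidiagonal_def image_iff)
  qed
  then have "(\<Sum>(i, j)\<in>antidiagonal (Suc n). f i j) =
      f (Suc n) 0 + (\<Sum>(i, j)\<in>(\<lambda>(i, j). (i, Suc j)) ` antidiagonal n. f i j)"
    by (simp only:) (subst sum.insert, auto)
  then show ?thesis
    by (subst (asm) sum.reindex) (auto simp: inj_on_def case_prod_beta)
qed

lemma sum_antidiagonal_Suc_left:
  "(\<Sum>(i, j)\<in>antidiagonal (Suc n). f i j) = f 0 (Suc n) + (\<Sum>(i, j)\<in>antidiagonal n. f (Suc i) j)"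
  using sum_antidiagonal_Suc_right[of "\<lambda>i j. f j i" n]
    sum_antidiagonal_swap[of f "Suc n"] sum_antidiagonal_swap[of "\<lambda>i j. f (Suc i) j" n]
  by simp

lemma sum_antidiagonal_mono_neutral:
  assumes "\<And>i j. i + j = n \<Longrightarrow> \<not> P i j \<Longrightarrow> f i j = 0"
  shows "(\<Sum>(i, j)\<in>{(i, j). i + j = n \<and> P i j}. f i j) = (\<Sum>(i, j)\<in>antidiagonal n. f i j)"
  by (rule sum.mono_neutral_left[OF finite_antidiagonal]) (use assms in \<open>force simp: antidiagonal_def\<close>)+

lemma sum_fun_apply: "(\<Sum>a\<in>A. f a) x = (\<Sum>a\<in>A. f a x)"
  by (induction A rule: infinite_finite_induct) auto

text \<open>Composition of tuples read as polynomials in a formal variable whose powers number the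
  components. Unlike in \<open>bracket_c\<close>, no index ranges are imposed.\<close>

definition convolution ::
  "('a, 'k::field) sym_maps \<Rightarrow> ('a, 'k) sym_maps \<Rightarrow> ('a, 'k) sym_maps" where
  "convolution F G = (\<lambda>n x. \<Sum>(p, q)\<in>antidiagonal n. F p (G q x))"

context graded
begin

section \<open>Tuples of coderivations and their brackets\<close>

lemma SV_endo_diff:
  assumes "SV_endo f" "x \<in> SV sc V" "y \<in> SV sc V"
  shows "f (x - y) = f x - f y"
  using SV_endoD(2)[OF assms(1,2) fs.subspace_scale[OF subspace_SV assms(3), of "- 1"]]
    SV_endoD(3)[OF assms(1,3), of "- 1"]
  by simp

lemma SV_endo_0: "SV_endo f \<Longrightarrow> f 0 = 0"
  using SV_endo_diff[of f 0 0] fs.subspace_0[OF subspace_SV[of sc V]] by simp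

lemma SV_endo_sum:
  assumes f: "SV_endo f" and "\<And>a. a \<in> A \<Longrightarrow> g a \<in> SV sc V"
  shows "f (\<Sum>a\<in>A. g a) = (\<Sum>a\<in>A. f (g a))"
  using assms(2)
proof (induction A rule: infinite_finite_induct)
  case (insert a A)
  then have "f (g a + sum g A) = f (g a) + f (sum g A)"
    by (intro SV_endoD(2)[OF f] fs.subspace_sum[OF subspace_SV]) auto
  with insert show ?case
    by (simp only: sum.insert insert_iff simp_thms)
qed (simp_all add: SV_endo_0[OF f])

text \<open>Holds for every \<open>x\<close>, because coderivations are 0 off
  \<open>SV\<close>.\<close>

lemma Coder_in_SV: "D \<in> Coder sc V n \<Longrightarrow> D x \<in> SV sc V"
  using SV_endoD(1)[OF Coder_SV_endo] CoderD(2) fs.subspace_0[OF subspace_SV[of sc V]] by metis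

lemma Coder_add:
  assumes "D \<in> Coder sc V n" "E \<in> Coder sc V n"
  shows "D + E \<in> Coder sc V n"
proof -
  have "D + E = (\<lambda>x. fscale 1 (D x) + E x)" by (simp add: fun_eq_iff)
  then show ?thesis using Coder_lincomb[OF assms, of 1] by simp
qed

lemma Coder_scale: "D \<in> Coder sc V n \<Longrightarrow> (\<lambda>x. fscale c (D x)) \<in> Coder sc V n"
  using Coder_lincomb[OF _ zero_in_Coder, of D n c] by simp

lemma Coder_sum:
  "(\<And>a. a \<in> A \<Longrightarrow> f a \<in> Coder sc V n) \<Longrightarrow> (\<Sum>a\<in>A. f a) \<in> Coder sc V n"
  by (induction A rule: infinite_finite_induct) (auto intro: zero_in_Coder Coder_add)

lemma Coder_c_component:
  assumes "D \<in> Coder_c sc V n"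
  shows "D i \<in> Coder sc V (int n)"
  using assms zero_in_Coder by (cases "i \<in> {1..n + 1}") (auto simp: Coder_c_def)

lemma Coder_c_outside: "D \<in> Coder_c sc V n \<Longrightarrow> i \<notin> {1..n + 1} \<Longrightarrow> D i = 0"
  by (simp add: Coder_c_def)

lemma zero_in_Coder_c: "0 \<in> Coder_c sc V n"
  by (simp add: Coder_c_def zero_in_Coder)

lemma Coder_c_add: "D \<in> Coder_c sc V n \<Longrightarrow> E \<in> Coder_c sc V n \<Longrightarrow> D + E \<in> Coder_c sc V n"
  by (simp add: Coder_c_def Coder_add)

lemma Coder_c_scale: "D \<in> Coder_c sc V n \<Longrightarrow> scale_c c D \<in> Coder_c sc V n"
  by (auto simp: Coder_c_def scale_c_def Coder_scale)

lemma Coder_c_diff: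
  assumes "D \<in> Coder_c sc V n" "E \<in> Coder_c sc V n"
  shows "D - E \<in> Coder_c sc V n"
proof -
  have eq: "D - E = D + scale_c (- 1) E"
    by (simp add: fun_eq_iff scale_c_def fscale_def)
  show ?thesis unfolding eq by (intro Coder_c_add Coder_c_scale assms)
qed

lemma Coder_c_sum:
  "(\<And>a. a \<in> A \<Longrightarrow> f a \<in> Coder_c sc V n) \<Longrightarrow> (\<Sum>a\<in>A. f a) \<in> Coder_c sc V n"
  by (induction A rule: infinite_finite_induct) (auto intro: zero_in_Coder_c Coder_c_add)

lemma bracket_c_in_Coder_c:
  assumes "D \<in> Coder_c sc V m" "E \<in> Coder_c sc V n"
  shows "bracket_c m n D E \<in> Coder_c sc V (m + n)"
proof -
  have "commutator (int m) (int n) (D p) (E q) \<in> Coder sc V (int (m + n))" for p q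
    using commutator_in_Coder[OF Coder_c_component Coder_c_component] assms by simp
  then show ?thesis
    by (auto simp: Coder_c_def bracket_c_def intro!: Coder_sum)
qed

lemma bracket_c_convolution:
  assumes D: "D \<in> Coder_c sc V m" and E: "E \<in> Coder_c sc V n"
  shows "bracket_c m n D E i x =
    convolution D E (i + 1) x - fscale ((-1) powi (int m * int n)) (convolution E D (i + 1) x)"
proof -
  let ?s = "(-1 :: 'k) powi (int m * int n)"
  let ?t = "\<lambda>p q. commutator (int m) (int n) (D p) (E q) x"
  have zero: "?t p q = 0" if "\<not> (p \<in> {1..m + 1} \<and> q \<in> {1..n + 1})" for p q
    using that SV_endo_0[OF Coder_SV_endo[OF Coder_c_component[OF D]]]
      SV_endo_0[OF Coder_SV_endo[OF Coder_c_component[OF E]]]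
      Coder_c_outside[OF D, of p] Coder_c_outside[OF E, of q]
    by (auto simp: commutator_def)
  have "bracket_c m n D E i x = (\<Sum>(p, q)\<in>antidiagonal (i + 1). ?t p q)"
  proof (cases "i \<in> {1..m + n + 1}")
    case True
    then have "bracket_c m n D E i x =
        (\<Sum>(p, q)\<in>{(p, q). p + q = i + 1 \<and> (p \<in> {1..m + 1} \<and> q \<in> {1..n + 1})}. ?t p q)"
      by (simp add: bracket_c_def sum_fun_apply case_prod_beta)
    also have "\<dots> = (\<Sum>(p, q)\<in>antidiagonal (i + 1). ?t p q)"
      by (rule sum_antidiagonal_mono_neutral) (rule zero)
    finally show ?thesis .
  next
    case False
    \<comment> \<open>For \<open>i = 0\<close> one of \<open>p\<close>, \<open>q\<close> is 0; for
      \<open>i > m + n + 1\<close> one of them exceeds its upper bound.\<close>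
    then have "(\<Sum>(p, q)\<in>antidiagonal (i + 1). ?t p q) = 0"
      by (intro sum.neutral ballI) (auto simp: antidiagonal_def intro!: zero)
    with False show ?thesis by (auto simp: bracket_c_def)
  qed
  also have "\<dots> = (\<Sum>(p, q)\<in>antidiagonal (i + 1). D p (E q x)) -
      fscale ?s (\<Sum>(p, q)\<in>antidiagonal (i + 1). E q (D p x))"
    by (simp add: commutator_def sum_subtractf case_prod_beta fs.scale_sum_right)
  also have "(\<Sum>(p, q)\<in>antidiagonal (i + 1). E q (D p x)) = (\<Sum>(p, q)\<in>antidiagonal (i + 1). E p (D q x))"
    by (rule sum_antidiagonal_swap)
  finally show ?thesis unfolding convolution_def .
qed

text \<open>In degree 1 the sign is -1, so the graded commutator is an anticommutator and the
  bracket is symmetric.\<close>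

lemma bracket_c_degree_one:
  assumes "D \<in> Coder_c sc V 1" "E \<in> Coder_c sc V 1"
  shows "bracket_c 1 1 D E i x = convolution D E (i + 1) x + convolution E D (i + 1) x"
  unfolding bracket_c_convolution[OF assms] by (simp add: fs.scale_minus_left)

lemma bracket_c_degree_one_sym:
  assumes "D \<in> Coder_c sc V 1" "E \<in> Coder_c sc V 1"
  shows "bracket_c 1 1 D E = bracket_c 1 1 E D"
  by (intro ext) (simp only: bracket_c_degree_one assms add.commute)

lemma bracket_c_diff_right:
  assumes D: "D \<in> Coder_c sc V m" and E: "E \<in> Coder_c sc V n" and F: "F \<in> Coder_c sc V n"
  shows "bracket_c m n D (E - F) = bracket_c m n D E - bracket_c m n D F"
proof (intro ext)
  fix i x \<phi>
  have "D p (E q x - F q x) = D p (E q x) - D p (F q x)" for p q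
    by (intro SV_endo_diff Coder_SV_endo[OF Coder_c_component[OF D]]
          Coder_in_SV[OF Coder_c_component[OF E]] Coder_in_SV[OF Coder_c_component[OF F]])
  then have "convolution D (E - F) k x = convolution D E k x - convolution D F k x"
    "convolution (E - F) D k x = convolution E D k x - convolution F D k x" for k
    by (simp_all add: convolution_def sum_subtractf case_prod_beta)
  then show "bracket_c m n D (E - F) i x \<phi> = (bracket_c m n D E - bracket_c m n D F) i x \<phi>"
    by (simp add: bracket_c_convolution D E F Coder_c_diff fs.scale_right_diff_distrib)
qed

lemma bracket_c_zero_right:
  assumes "D \<in> Coder_c sc V m"
  shows "bracket_c m n D 0 = 0"
  using bracket_c_diff_right[OF assms zero_in_Coder_c zero_in_Coder_c] by simp

text \<open>This is \<open>A\<^sub>n\<close> of the introduction: the coefficient of the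
  \<open>n\<close>-th power of \<open>t\<close> in the composite of the formal sum of the
  \<open>X i\<close> with itself.\<close>

definition square :: "(nat \<Rightarrow> ('a, 'k) sym_maps) \<Rightarrow> nat \<Rightarrow> ('a, 'k) sym_maps" where
  "square X n = (\<Sum>(i, j)\<in>antidiagonal n. convolution (X i) (X j))"

lemma square_apply:
  "square X n c x = (\<Sum>(i, j)\<in>antidiagonal n. \<Sum>(p, q)\<in>antidiagonal c. X i p (X j q x))"
  by (simp add: square_def convolution_def sum_fun_apply case_prod_beta)

text \<open>Associativity of composition, in the form \<open>X \<star> (X \<star> X) = (X \<star> X) \<star> X\<close> for the product \<open>\<star>\<close>
  of sequences of sequences of maps; it replaces the Jacobi identity.\<close>

lemma square_assoc:
  assumes X: "\<And>i. X i \<in> Coder_c sc V m"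
  shows "(\<Sum>(i, j)\<in>antidiagonal n. convolution (X i) (square X j) c x) =
    (\<Sum>(i, j)\<in>antidiagonal n. convolution (square X i) (X j) c x)"
proof -
  let ?f = "\<lambda>i p k r l s. X i p (X k r (X l s x))"
  have SV: "X i p y \<in> SV sc V" for i p y
    by (rule Coder_in_SV[OF Coder_c_component[OF X]])
  have endo: "SV_endo (X i p)" for i p
    by (rule Coder_SV_endo[OF Coder_c_component[OF X]])
  have expand: "X i p (square X j q x) =
      (\<Sum>(k, l)\<in>antidiagonal j. \<Sum>(r, s)\<in>antidiagonal q. ?f i p k r l s)" for i p j q
  proof -
    have "X i p (square X j q x) =
        (\<Sum>a\<in>antidiagonal j. X i p (\<Sum>b\<in>antidiagonal q. X (fst a) (fst b) (X (snd a) (snd b) x)))"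
      unfolding square_apply case_prod_beta
      by (rule SV_endo_sum[OF endo]) (rule fs.subspace_sum[OF subspace_SV], rule SV)
    also have "\<dots> = (\<Sum>a\<in>antidiagonal j. \<Sum>b\<in>antidiagonal q. X i p (X (fst a) (fst b) (X (snd a) (snd b) x)))"
      by (rule sum.cong[OF refl]) (rule SV_endo_sum[OF endo], rule SV)
    finally show ?thesis by (simp add: case_prod_beta)
  qed
  have "(\<Sum>(i, j)\<in>antidiagonal n. convolution (X i) (square X j) c x) =
      (\<Sum>(i, j)\<in>antidiagonal n. \<Sum>(k, l)\<in>antidiagonal j.
        \<Sum>(p, q)\<in>antidiagonal c. \<Sum>(r, s)\<in>antidiagonal q. ?f i p k r l s)"
    unfolding convolution_def expand case_prod_beta
    by (rule sum.cong[OF refl]) (rule sum.swap)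
  \<comment> \<open>Regrouping happens twice: here in the component index, next in the power of
    \<open>t\<close>.\<close>
  also have "\<dots> = (\<Sum>(i, j)\<in>antidiagonal n. \<Sum>(k, l)\<in>antidiagonal j.
        \<Sum>(p, q)\<in>antidiagonal c. \<Sum>(r, s)\<in>antidiagonal p. ?f i r k s l q)"
    by (rule sum.cong[OF refl], clarify, rule sum.cong[OF refl], clarify, rule sum_antidiagonal_assoc)
  also have "\<dots> = (\<Sum>(i, j)\<in>antidiagonal n. \<Sum>(k, l)\<in>antidiagonal i.
        \<Sum>(p, q)\<in>antidiagonal c. \<Sum>(r, s)\<in>antidiagonal p. ?f k r l s j q)"
    by (rule sum_antidiagonal_assoc)
  also have "\<dots> = (\<Sum>(i, j)\<in>antidiagonal n. convolution (square X i) (X j) c x)"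
    unfolding convolution_def square_apply case_prod_beta
    by (rule sum.cong[OF refl]) (rule sum.swap)
  finally show ?thesis .
qed

text \<open>Tuples have no component 0. This removes the boundary terms that arise when component
  indices are shifted.\<close>

lemma square_0:
  assumes X: "\<And>i. X i \<in> Coder_c sc V m"
  shows "square X n 0 x = 0"
proof -
  have "X i 0 = 0" for i by (rule Coder_c_outside[OF X]) simp
  then show ?thesis
    by (auto simp: square_apply antidiagonal_def intro!: sum.neutral)
qed

text \<open>Each bracket is an anticommutator, and exchanging \<open>i\<close> and \<open>j\<close>
  shows that its two halves have the same sum.\<close>

lemma sum_bracket_c_square:
  assumes X: "\<And>i. X i \<in> Coder_c sc V 1"
  shows "(\<Sum>(i, j)\<in>antidiagonal n. bracket_c 1 1 (X i) (X j)) k x = fscale 2 (square X n (k + 1) x)"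
proof -
  have "(\<Sum>(i, j)\<in>antidiagonal n. bracket_c 1 1 (X i) (X j)) k x =
      (\<Sum>(i, j)\<in>antidiagonal n. convolution (X i) (X j) (k + 1) x) +
      (\<Sum>(i, j)\<in>antidiagonal n. convolution (X j) (X i) (k + 1) x)"
    unfolding sum.distrib[symmetric]
    by (simp only: sum_fun_apply case_prod_beta bracket_c_degree_one[OF X X])
  also have "\<dots> = square X n (k + 1) x + square X n (k + 1) x"
    unfolding sum_antidiagonal_swap[of "\<lambda>i j. convolution (X j) (X i) (k + 1) x"]
    by (simp add: square_def sum_fun_apply case_prod_beta)
  finally show ?thesis by (simp add: fscale_def fun_eq_iff)
qed

end

section \<open>Deformations and their obstruction\<close>

text \<open>At order \<open>N + 1\<close> the two ends carry the coefficient of the extension, and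
  the rest is the sum in the obstruction.\<close>

lemma sum_antidiagonal_split_ends:
  "(\<Sum>(i, j)\<in>antidiagonal (Suc n). f i j) =
    f 0 (Suc n) + (f (Suc n) 0 + (\<Sum>(i, j)\<in>{(i, j). i + j = Suc n \<and> 1 \<le> i \<and> 1 \<le> j}. f i j))"
proof -
  let ?I = "{(i, j). i + j = Suc n \<and> 1 \<le> i \<and> 1 \<le> j}"
  have "antidiagonal (Suc n) = insert (0, Suc n) (insert (Suc n, 0) ?I)"
    by (auto simp: antidiagonal_def)
  moreover have "finite ?I"
    by (rule finite_subset[OF _ finite_antidiagonal[of "Suc n"]]) (auto simp: antidiagonal_def)
  ultimately show ?thesis by simp
qed

context graded
begin

lemma square_in_SV:
  assumes "\<And>i. X i \<in> Coder_c sc V m"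
  shows "square X n c x \<in> SV sc V"
  unfolding square_apply case_prod_beta
  by (intro fs.subspace_sum[OF subspace_SV] Coder_in_SV[OF Coder_c_component[OF assms]])

end

text \<open>The differential of the complex appears here as the bracket with
  \<open>DD 0\<close>.\<close>

locale deformation = graded sc V
  for sc :: "'k::field_char_0 \<Rightarrow> 'a::ab_group_add \<Rightarrow> 'a" and V :: "int \<Rightarrow> 'a set" +
  fixes N :: nat and DD :: "nat \<Rightarrow> ('a, 'k) sym_maps"
  assumes DD_Coder_c: "DD i \<in> Coder_c sc V 1"
    and DD_above: "N < i \<Longrightarrow> DD i = 0"
    and DD_bracket: "n \<le> N \<Longrightarrow> (\<Sum>(i, j)\<in>antidiagonal n. bracket_c 1 1 (DD i) (DD j)) = 0"
begin

lemma square_DD_eq_0: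
  assumes "n \<le> N"
  shows "square DD n c x = 0"
proof (cases c)
  case 0
  then show ?thesis using square_0[of DD 1, OF DD_Coder_c] by simp
next
  case (Suc k)
  have "fscale 2 (square DD n (k + 1) x) = 0"
    unfolding sum_bracket_c_square[OF DD_Coder_c, symmetric] DD_bracket[OF assms] by simp
  \<comment> \<open>Characteristic 0 allows division by 2.\<close>
  then show ?thesis using Suc by simp
qed

lemma obstruction_in_Coder_c: "obstruction N DD \<in> Coder_c sc V 2"
  unfolding obstruction_def case_prod_beta
  using bracket_c_in_Coder_c[OF DD_Coder_c DD_Coder_c]
  by (intro Coder_c_scale Coder_c_sum) (simp add: numeral_2_eq_2)

text \<open>As \<open>DD (N + 1)\<close> is 0, the end terms of the antidiagonal may be added to the
  obstruction sum. The factor 2 of \<open>sum_bracket_c_square\<close> then cancels against -1/2, up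
  to sign.\<close>

lemma obstruction_eq_square: "obstruction N DD k x = - square DD (N + 1) (k + 1) x"
proof -
  have "bracket_c 1 1 (DD 0) (DD (Suc N)) = 0"
    unfolding DD_above[OF lessI] by (rule bracket_c_zero_right[OF DD_Coder_c])
  moreover from this have "bracket_c 1 1 (DD (Suc N)) (DD 0) = 0"
    unfolding bracket_c_degree_one_sym[OF DD_Coder_c DD_Coder_c, of "Suc N" 0] .
  ultimately have "obstruction N DD =
      scale_c (- (1 / 2)) (\<Sum>(i, j)\<in>antidiagonal (N + 1). bracket_c 1 1 (DD i) (DD j))"
    unfolding obstruction_def Suc_eq_plus1[symmetric] sum_antidiagonal_split_ends by simp
  then have "obstruction N DD k x = fscale (- (1 / 2)) (fscale 2 (square DD (N + 1) (k + 1) x))"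
    by (simp only: scale_c_def sum_bracket_c_square[OF DD_Coder_c])
  then show ?thesis by (simp add: fscale_def fun_eq_iff)
qed

text \<open>In \<open>square_assoc\<close> at order \<open>N + 1\<close> every square of order at
  most \<open>N\<close> vanishes, which leaves a single term on each side.\<close>

lemma convolution_square_commute:
  "convolution (DD 0) (square DD (N + 1)) c x = convolution (square DD (N + 1)) (DD 0) c x"
proof -
  have "convolution (DD i) (square DD j) c x = 0" if "j \<le> N" for i j
    using SV_endo_0[OF Coder_SV_endo[OF Coder_c_component[OF DD_Coder_c]]]
    by (simp add: convolution_def square_DD_eq_0[OF that] case_prod_beta)
  then have "(\<Sum>(i, j)\<in>antidiagonal (Suc N). convolution (DD i) (square DD j) c x) =
      convolution (DD 0) (square DD (Suc N)) c x"
    unfolding sum_antidiagonal_Suc_left by (auto simp: antidiagonal_def intro!: sum.neutral)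
  moreover have "convolution (square DD i) (DD j) c x = 0" if "i \<le> N" for i j
    by (simp add: convolution_def square_DD_eq_0[OF that] case_prod_beta)
  then have "(\<Sum>(i, j)\<in>antidiagonal (Suc N). convolution (square DD i) (DD j) c x) =
      convolution (square DD (Suc N)) (DD 0) c x"
    unfolding sum_antidiagonal_Suc_right by (auto simp: antidiagonal_def intro!: sum.neutral)
  ultimately show ?thesis
    using square_assoc[where X = DD and n = "Suc N" and c = c and x = x, OF DD_Coder_c] by simp
qed

text \<open>The cocycle condition. For degrees 1 and 2 the sign is +1, so the bracket is an ordinary
  commutator, and \<open>convolution_square_commute\<close> applies once the component shift between
  \<open>obstruction\<close> and \<open>square\<close> is accounted for.\<close>

lemma bracket_c_obstruction: "bracket_c 1 2 (DD 0) (obstruction N DD) = 0"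
proof (intro ext)
  fix k x \<phi>
  have neg: "DD 0 p (- y) = - DD 0 p y" if "y \<in> SV sc V" for p y
    using SV_endoD(3)[OF Coder_SV_endo[OF Coder_c_component[OF DD_Coder_c]] that, where c = "- 1"]
    by simp
  have "convolution (DD 0) (obstruction N DD) (k + 1) x =
      - (\<Sum>(p, q)\<in>antidiagonal (k + 1). DD 0 p (square DD (N + 1) (Suc q) x))"
    unfolding convolution_def obstruction_eq_square neg[OF square_in_SV[OF DD_Coder_c]]
    by (simp add: sum_negf case_prod_beta)
  \<comment> \<open>Passing from \<open>Suc q\<close> to all indices adds only the term with
    component 0 of the square, which is 0.\<close>
  also have "\<dots> = - convolution (DD 0) (square DD (N + 1)) (Suc (k + 1)) x"
    unfolding convolution_def sum_antidiagonal_Suc_right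
    using SV_endo_0[OF Coder_SV_endo[OF Coder_c_component[OF DD_Coder_c]]]
    by (simp add: square_0[OF DD_Coder_c])
  finally have left: "convolution (DD 0) (obstruction N DD) (k + 1) x = \<dots>" .
  have "convolution (obstruction N DD) (DD 0) (k + 1) x =
      - (\<Sum>(p, q)\<in>antidiagonal (k + 1). square DD (N + 1) (Suc p) (DD 0 q x))"
    unfolding convolution_def obstruction_eq_square
    by (simp add: sum_negf case_prod_beta)
  also have "\<dots> = - convolution (square DD (N + 1)) (DD 0) (Suc (k + 1)) x"
    unfolding convolution_def sum_antidiagonal_Suc_left
    by (simp add: square_0[OF DD_Coder_c])
  finally have right: "convolution (obstruction N DD) (DD 0) (k + 1) x = \<dots>" .
  show "bracket_c 1 2 (DD 0) (obstruction N DD) k x \<phi> = 0 k x \<phi>"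
    unfolding bracket_c_convolution[OF DD_Coder_c obstruction_in_Coder_c] left right
      convolution_square_commute by simp
qed

text \<open>\<open>X\<close> enters only through the two end terms, which are equal by symmetry.
  With \<open>B\<close> the bracket of \<open>DD 0\<close> and \<open>X\<close>, the equation reads
  \<open>2 B + S = 0\<close>, and 2 is invertible.\<close>

lemma sum_bracket_c_update_eq_0_iff:
  assumes X: "X \<in> Coder_c sc V 1"
  shows "(\<Sum>(i, j)\<in>antidiagonal (N + 1).
      bracket_c 1 1 ((DD(N + 1 := X)) i) ((DD(N + 1 := X)) j)) = 0 \<longleftrightarrow>
    bracket_c 1 1 (DD 0) X = obstruction N DD"
proof -
  define B where "B = bracket_c 1 1 (DD 0) X"
  define S where "S = (\<Sum>(i, j)\<in>{(i, j). i + j = N + 1 \<and> 1 \<le> i \<and> 1 \<le> j}.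
      bracket_c 1 1 (DD i) (DD j))"
  \<comment> \<open>The inner terms have both indices at most \<open>N\<close> and do not see the
    update.\<close>
  have "(\<Sum>(i, j)\<in>{(i, j). i + j = N + 1 \<and> 1 \<le> i \<and> 1 \<le> j}.
      bracket_c 1 1 ((DD(N + 1 := X)) i) ((DD(N + 1 := X)) j)) = S"
    unfolding S_def by (rule sum.cong) auto
  then have "(\<Sum>(i, j)\<in>antidiagonal (N + 1).
      bracket_c 1 1 ((DD(N + 1 := X)) i) ((DD(N + 1 := X)) j)) = B + (B + S)"
    unfolding Suc_eq_plus1[symmetric] sum_antidiagonal_split_ends
    by (simp add: B_def bracket_c_degree_one_sym[OF X DD_Coder_c, unfolded One_nat_def])
  moreover have "b + (b + s) = 0 \<longleftrightarrow> b = - (1 / 2) * s" for b s :: 'k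
    by (auto simp: add_eq_0_iff field_simps)
  then have "B + (B + S) = 0 \<longleftrightarrow> B = scale_c (- (1 / 2)) S"
    by (simp add: fun_eq_iff scale_c_def fscale_def)
  ultimately show ?thesis
    by (simp only: B_def S_def obstruction_def)
qed

end

section \<open>The grading of the desuspension, and the zero class in cohomology\<close>

text \<open>A nonzero vector in two degrees would have two decompositions, one concentrated in each
  degree.\<close>

lemma graded_vector_space_degree_unique:
  assumes "graded_vector_space sc L" "x \<in> L d" "x \<in> L e" "d \<noteq> e"
  shows "x = 0"
proof (rule ccontr)
  assume "x \<noteq> 0"
  interpret vector_space sc
    using assms(1) by (simp add: graded_vector_space_def)
  let ?P = "\<lambda>c. finite {i. c i \<noteq> 0} \<and> (\<forall>i. c i \<in> L i) \<and> x = (\<Sum>i | c i \<noteq> 0. c i)"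
  have "0 \<in> L i" for i
    using assms(1) subspace_0 by (auto simp: graded_vector_space_def)
  then have single: "?P (\<lambda>i. if i = a then x else 0)" if "x \<in> L a" for a
    using that \<open>x \<noteq> 0\<close> by simp
  have "\<exists>!c. ?P c"
    using assms(1) unfolding graded_vector_space_def by (elim conjE) (rule spec)
  then obtain c where "\<And>c'. ?P c' \<Longrightarrow> c' = c"
    by (rule ex1E) (rule that, erule allE, erule mp)
  from this[OF single[OF assms(2)]] this[OF single[OF assms(3)]]
  have "(\<lambda>i. if i = d then x else 0) = (\<lambda>i. if i = e then x else 0)"
    by simp
  from fun_cong[OF this, of d] show False
    using \<open>x \<noteq> 0\<close> \<open>d \<noteq> e\<close> by simp
qed

lemma graded_desuspension:
  assumes "graded_vector_space sc L"
  shows "graded sc (desuspension L)"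
proof -
  interpret vector_space sc
    using assms by (simp add: graded_vector_space_def)
  show ?thesis
  proof
    show "subspace (desuspension L d)" for d
      using assms by (simp add: graded_vector_space_def desuspension_def)
    show "x = 0" if "x \<in> desuspension L d" "x \<in> desuspension L e" "d \<noteq> e" for x d e
      using graded_vector_space_degree_unique[OF assms, of x "d + 1" "e + 1"] that
      by (simp add: desuspension_def)
  qed
qed

text \<open>If the classes agree, that of \<open>z\<close> contains 0. Conversely, closure of the
  coboundaries under differences makes \<open>z - w\<close> and \<open>- w\<close> coboundaries for
  the same \<open>w\<close>.\<close>

lemma cohomology_class_eq_0_iff:
  assumes z: "z \<in> cocycles sc L l l' n" and zero: "0 \<in> cocycles sc L l l' n"
    and diff: "\<And>x y. x \<in> coboundaries sc L l l' n \<Longrightarrow> y \<in> coboundaries sc L l l' n \<Longrightarrow>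
      x - y \<in> coboundaries sc L l l' n"
    and zero': "0 \<in> coboundaries sc L l l' n"
  shows "cohomology_class sc L l l' n z = cohomology_class sc L l l' n 0 \<longleftrightarrow>
    z \<in> coboundaries sc L l l' n"
proof
  assume "cohomology_class sc L l l' n z = cohomology_class sc L l l' n 0"
  then have "0 \<in> cohomology_class sc L l l' n z"
    using zero zero' by (simp add: cohomology_class_def cohomologous_def)
  then show "z \<in> coboundaries sc L l l' n"
    by (simp add: cohomology_class_def cohomologous_def)
next
  assume zb: "z \<in> coboundaries sc L l l' n"
  have "z - w \<in> coboundaries sc L l l' n \<longleftrightarrow> 0 - w \<in> coboundaries sc L l l' n" for w
    using diff[OF _ zb, of "z - w"] diff[OF zb, of w] diff[OF zero', of "- w"] by auto
  then show "cohomology_class sc L l l' n z = cohomology_class sc L l l' n 0"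
    using z zero by (auto simp: cohomology_class_def cohomologous_def)
qed

theorem theorem5p8:
  fixes sc :: "'k::field_char_0 \<Rightarrow> 'a::ab_group_add \<Rightarrow> 'a"
    and L :: "int \<Rightarrow> 'a set"
    and l l' :: "nat \<Rightarrow> 'a list \<Rightarrow> 'a"
    and N :: nat
    and DD :: "nat \<Rightarrow> ('a, 'k) sym_maps"
  assumes "compatible_L_infinity_algebra sc L l l'"
    and "N \<ge> 1"
    and "order_deformation sc L l l' N DD"
  shows "obstruction N DD \<in> cocycles sc L l l' 3 \<and>
    (extensible sc L l l' N DD \<longleftrightarrow>
       cohomology_class sc L l l' 3 (obstruction N DD) = cohomology_class sc L l l' 3 0)"
proof -
  let ?V = "desuspension L"
  have def: "\<And>i. i \<le> N \<Longrightarrow> DD i \<in> Coder_c sc ?V 1" "\<And>i. N < i \<Longrightarrow> DD i = 0"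
    and DD0: "DD 0 = L_coder_c sc L l l'"
    and br: "\<And>n. n \<le> N \<Longrightarrow> (\<Sum>(i, j)\<in>antidiagonal n. bracket_c 1 1 (DD i) (DD j)) = 0"
    using assms(3) unfolding order_deformation_def antidiagonal_def by blast+
  interpret graded sc ?V
    using assms(1) by (intro graded_desuspension)
      (simp add: compatible_L_infinity_algebra_def L_infinity_algebra_def)
  interpret deformation sc ?V N DD
  proof
    \<comment> \<open>Above \<open>N\<close> the coefficient is the zero tuple, which is a tuple of
      coderivations.\<close>
    show "DD i \<in> Coder_c sc ?V 1" for i
      using def zero_in_Coder_c by (cases "i \<le> N") auto
  qed (use def br in auto)
  \<comment> \<open>Cochains of degree \<open>n\<close> are tuples of coderivations of degree
    \<open>n - 1\<close>, hence the degrees 2 and 1 here.\<close>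
  have delta: "delta_c sc L l l' 3 = bracket_c 1 2 (DD 0)"
    "delta_c sc L l l' 2 = bracket_c 1 1 (DD 0)"
    by (simp_all add: delta_c_def DD0)
  have cochains: "cochains sc L 3 = Coder_c sc ?V 2" "cochains sc L 2 = Coder_c sc ?V 1"
    by (simp_all add: cochains_def)
  have cob: "coboundaries sc L l l' 3 = bracket_c 1 1 (DD 0) ` Coder_c sc ?V 1"
    by (simp add: coboundaries_def cochains delta)
  have ob: "obstruction N DD \<in> cocycles sc L l l' 3"
    unfolding cocycles_def cochains delta
    using obstruction_in_Coder_c bracket_c_obstruction by simp
  have zero: "0 \<in> cocycles sc L l l' 3"
    unfolding cocycles_def cochains delta
    using zero_in_Coder_c bracket_c_zero_right[OF DD_Coder_c] by simp
  have diff: "x - y \<in> coboundaries sc L l l' 3"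
    if "x \<in> coboundaries sc L l l' 3" "y \<in> coboundaries sc L l l' 3" for x y
    using that bracket_c_diff_right[OF DD_Coder_c, symmetric] Coder_c_diff
    unfolding cob by (auto simp del: One_nat_def)
  have zero': "0 \<in> coboundaries sc L l l' 3"
    unfolding cob using bracket_c_zero_right[OF DD_Coder_c[of 0], where n = 1] zero_in_Coder_c
    by (metis image_eqI)
  \<comment> \<open>The equations up to order \<open>N\<close> are those of \<open>DD\<close>; the
    one of order \<open>N + 1\<close> says that the differential of \<open>X\<close> is the
    obstruction.\<close>
  have "order_deformation sc L l l' (N + 1) (DD(N + 1 := X)) \<longleftrightarrow>
      bracket_c 1 1 (DD 0) X = obstruction N DD" if X: "X \<in> Coder_c sc ?V 1" for X
  proof -
    have low: "(\<Sum>(i, j)\<in>antidiagonal n. bracket_c 1 1 ((DD(N + 1 := X)) i) ((DD(N + 1 := X)) j)) = 0"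
      if "n \<le> N" for n
      unfolding DD_bracket[OF that, symmetric]
      by (rule sum.cong) (use that in \<open>auto simp: antidiagonal_def\<close>)
    have "(\<forall>n\<le>N + 1. (\<Sum>(i, j)\<in>antidiagonal n.
          bracket_c 1 1 ((DD(N + 1 := X)) i) ((DD(N + 1 := X)) j)) = 0) \<longleftrightarrow>
        bracket_c 1 1 (DD 0) X = obstruction N DD"
      unfolding sum_bracket_c_update_eq_0_iff[OF X, symmetric]
      using low by (metis le_Suc_eq order_refl Suc_eq_plus1)
    then show ?thesis
      unfolding order_deformation_def antidiagonal_def[symmetric]
      using X DD_Coder_c DD_above by (auto simp: DD0)
  qed
  then have "extensible sc L l l' N DD \<longleftrightarrow> obstruction N DD \<in> coboundaries sc L l l' 3"
    unfolding extensible_def cob by (auto simp: image_iff eq_commute)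
  with ob cohomology_class_eq_0_iff[OF ob zero diff zero'] show ?thesis by blast
qed

end
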